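(* Let $\mathfrak{g}$ be a $Q$-good Lie algebra (with respect to $\pi: Q\to\mathbb{Z}$), let $\varphi:\mathfrak{n}\to\mathbb{C}$ be a homomorphism of Lie algebras, and let $I$ be an ideal of $A=S(Z'')$. Then any nontrivial (i.e. nonzero) submodule of the $\mathfrak{g}$-module $V=M_\varphi/IM_\varphi$ contains a nonzero Whittaker vector (of type $\varphi$).
   Context: Setting. $Q$ is a free abelian group with a total order $\leq$ compatible with its group structure, and $\pi:Q\to\mathbb{Z}$ is a homomorphism of abelian groups that preserves the ordering ($\alpha\le\beta$ implies $\pi(\alpha)\le\pi(\beta)$). $\mathfrak{g}=\bigoplus_{\alpha\in Q}\mathfrak{g}_\alpha$ is a $Q$-graded Lie algebra over $\mathbb{C}$, i.e. $[\mathfrak{g}_\alpha,\mathfrak{g}_\beta]\subseteq\mathfrak{g}_{\alpha+\beta}$. $Z$ is the center of $\mathfrak{g}$; it is a graded ideal. Put $Q'=\{\alpha\in Q:\pi(\alpha)>0\}$, $Q''=\{\alpha\in Q:\pi(\alpha)\le 0\}$, $\mathfrak{n}=\bigoplus_{\alpha\in Q'}\mathfrak{g}_\alpha$, $\mathfrak{b}_-=\bigoplus_{\alpha\in Q''}\mathfrak{g}_\alpha$, so $\mathfrak{g}=\mathfrak{b}_-\oplus\mathfrak{n}$. $\mathfrak{g}$ is called $Q$-good if $\dim\mathfrak{g}_\alpha\le 1$ for all $\alpha\in Q'$ and $\dim(\mathfrak{g}/Z)_\alpha\le 1$ for all $\alpha\in Q''$. $Z''=Z\cap\mathfrak{b}_-$;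 $U(\cdot)$ is the universal enveloping algebra, and $S(Z'')$ is the symmetric algebra of $Z''$, viewed as the (central) subalgebra $U(Z'')$ of $U(\mathfrak{g})$. Whittaker modules. A vector $v$ in a $\mathfrak{g}$-module $V$ is a Whittaker vector of type $\varphi$ if $xv=\varphi(x)v$ for all $x\in\mathfrak{n}$. $\mathbb{C}_\varphi$ is the one-dimensional $\mathfrak{n}$-module with $xa=\varphi(x)a$, and $M_\varphi=U(\mathfrak{g})\otimes_{U(\mathfrak{n})}\mathbb{C}_\varphi$. *)

theory Defs
  imports Complex_Main "HOL-Library.Poly_Mapping" "HOL-Algebra.Free_Abelian_Groups"
    "HOL-Algebra.Algebraic_Closure_Type"
begin

section \<open>Modules over arbitrary rings\<close>

text \<open>
  All modules are stored in the record type of \<^theory>\<open>HOL-Algebra.Module\<close>, but the scalars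
  may form a noncommutative ring.  The ring fields \<open>mult\<close> and \<open>one\<close> inherited by that record play
  no role for a module and are left unspecified.
\<close>

definition mk_module ::
    "'m set \<Rightarrow> 'm \<Rightarrow> ('m \<Rightarrow> 'm \<Rightarrow> 'm) \<Rightarrow> ('r \<Rightarrow> 'm \<Rightarrow> 'm) \<Rightarrow> ('r, 'm) module" where
  "mk_module C z a s =
     \<lparr>carrier = C, monoid.mult = undefined, monoid.one = undefined,
      ring.zero = z, ring.add = a, module.smult = s\<rparr>"

definition quot_module :: "('r, 'm) module \<Rightarrow> 'm set \<Rightarrow> ('r, 'm set) module" where
  "quot_module M N =
     mk_module (a_rcosets\<^bsub>M\<^esub> N) N (set_add M) (\<lambda>r Y. \<Union>x\<in>Y. N +>\<^bsub>M\<^esub> (r \<odot>\<^bsub>M\<^esub> x))"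

definition finite_basis :: "(complex, 'm) module \<Rightarrow> 'm set \<Rightarrow> bool" where
  "finite_basis M B \<longleftrightarrow> finite B \<and> B \<subseteq> carrier M \<and>
     (\<forall>x\<in>carrier M. \<exists>!c. (\<forall>b. b \<notin> B \<longrightarrow> c b = 0) \<and> x = (\<Oplus>\<^bsub>M\<^esub>b\<in>B. c b \<odot>\<^bsub>M\<^esub> b))"

definition dim_le_one :: "(complex, 'm) module \<Rightarrow> bool" where
  "dim_le_one M \<longleftrightarrow> (\<exists>B. finite_basis M B \<and> card B \<le> 1)"

text \<open>
  For a ring homomorphism \<open>h\<close> from \<open>R\<close> to \<open>U\<close> and a left \<open>R\<close>-module \<open>N\<close>, the left \<open>U\<close>-module
  \<open>U \<otimes>\<^sub>R N\<close>, where \<open>U\<close> is a right \<open>R\<close>-module through \<open>h\<close>.  As usual it is the free abelian group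
  on \<open>U \<times> N\<close> modulo the biadditivity and balancing relations.
\<close>

definition tensor_rels ::
    "('u, 'a) ring_scheme \<Rightarrow> ('r, 'b) ring_scheme \<Rightarrow> ('r \<Rightarrow> 'u) \<Rightarrow> ('r, 'n) module
      \<Rightarrow> ('u \<times> 'n \<Rightarrow>\<^sub>0 int) set" where
  "tensor_rels U R h N =
     {frag_of (u \<oplus>\<^bsub>U\<^esub> u', n) - frag_of (u, n) - frag_of (u', n) | u u' n.
        u \<in> carrier U \<and> u' \<in> carrier U \<and> n \<in> carrier N} \<union>
     {frag_of (u, n \<oplus>\<^bsub>N\<^esub> n') - frag_of (u, n) - frag_of (u, n') | u n n'.
        u \<in> carrier U \<and> n \<in> carrier N \<and> n' \<in> carrier N} \<union>
     {frag_of (u \<otimes>\<^bsub>U\<^esub> h r, n) - frag_of (u, r \<odot>\<^bsub>N\<^esub> n) | u r n.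
        u \<in> carrier U \<and> r \<in> carrier R \<and> n \<in> carrier N}"

definition tensor_module ::
    "('u, 'a) ring_scheme \<Rightarrow> ('r, 'b) ring_scheme \<Rightarrow> ('r \<Rightarrow> 'u) \<Rightarrow> ('r, 'n) module
      \<Rightarrow> ('u, ('u \<times> 'n \<Rightarrow>\<^sub>0 int) set) module" where
  "tensor_module U R h N =
     (let F = free_Abelian_group (carrier U \<times> carrier N);
          H = generate F (tensor_rels U R h N)
      in mk_module (rcosets\<^bsub>F\<^esub> H) H (set_mult F)
           (\<lambda>u Y. \<Union>x\<in>Y. H #>\<^bsub>F\<^esub> frag_extend (\<lambda>(v, n). frag_of (u \<otimes>\<^bsub>U\<^esub> v, n)) x))"


section \<open>Lie algebras and gradings\<close>

locale lie_algebra = vector_space scale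
  for scale :: "complex \<Rightarrow> 'g::ab_group_add \<Rightarrow> 'g" +
  fixes bracket :: "'g \<Rightarrow> 'g \<Rightarrow> 'g"
  assumes bracket_linear_right: "Vector_Spaces.linear scale scale (\<lambda>y. bracket x y)"
    and bracket_linear_left: "Vector_Spaces.linear scale scale (\<lambda>x. bracket x y)"
    and bracket_self: "bracket x x = 0"
    and jacobi: "bracket x (bracket y z) + bracket y (bracket z x) + bracket z (bracket x y) = 0"

definition lie_center :: "('g::ab_group_add \<Rightarrow> 'g \<Rightarrow> 'g) \<Rightarrow> 'g set" where
  "lie_center bracket = {z. \<forall>x. bracket z x = 0}"

text \<open>The graded pieces form an internal direct sum: every element is, in a unique way, the sum of
  a finitely supported family of homogeneous components.\<close>

locale graded_lie_algebra = lie_algebra scale bracket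
  for scale :: "complex \<Rightarrow> 'g::ab_group_add \<Rightarrow> 'g" and bracket :: "'g \<Rightarrow> 'g \<Rightarrow> 'g" +
  fixes gr :: "'q::linordered_ab_group_add \<Rightarrow> 'g set"
  assumes gr_subspace: "subspace (gr \<alpha>)"
    and gr_direct_sum:
      "\<exists>!c :: 'q \<Rightarrow>\<^sub>0 'g. (\<forall>\<alpha>. Poly_Mapping.lookup c \<alpha> \<in> gr \<alpha>) \<and>
         x = (\<Sum>\<alpha>\<in>Poly_Mapping.keys c. Poly_Mapping.lookup c \<alpha>)"
    and gr_bracket: "x \<in> gr \<alpha> \<Longrightarrow> y \<in> gr \<beta> \<Longrightarrow> bracket x y \<in> gr (\<alpha> + \<beta>)"

definition lie_space :: "(complex \<Rightarrow> 'g::ab_group_add \<Rightarrow> 'g) \<Rightarrow> (complex, 'g) module" where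
  "lie_space scale = mk_module UNIV 0 (+) scale"

text \<open>The component of degree \<open>\<alpha>\<close> of the graded space \<open>\<gg>/Z\<close> is the image of \<open>gr \<alpha>\<close>.\<close>

definition Q_good ::
    "(complex \<Rightarrow> 'g::ab_group_add \<Rightarrow> 'g) \<Rightarrow> ('g \<Rightarrow> 'g \<Rightarrow> 'g) \<Rightarrow> ('q \<Rightarrow> 'g set) \<Rightarrow> ('q \<Rightarrow> int) \<Rightarrow> bool"
  where
  "Q_good scale bracket gr \<pi> \<longleftrightarrow>
     (\<forall>\<alpha>. \<pi> \<alpha> > 0 \<longrightarrow> dim_le_one ((lie_space scale)\<lparr>carrier := gr \<alpha>\<rparr>)) \<and>
     (\<forall>\<alpha>. \<pi> \<alpha> \<le> 0 \<longrightarrow>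
        (let Z = lie_center bracket; g = lie_space scale
         in dim_le_one ((quot_module g Z)\<lparr>carrier := (\<lambda>x. Z +>\<^bsub>g\<^esub> x) ` gr \<alpha>\<rparr>)))"

definition free_abelian :: "'q::ab_group_add itself \<Rightarrow> bool" where
  "free_abelian _ \<longleftrightarrow>
     (\<exists>B :: 'q set. \<lparr>carrier = UNIV :: 'q set, monoid.mult = (+), monoid.one = 0\<rparr> \<cong> free_Abelian_group B)"

definition n_plus ::
    "(complex \<Rightarrow> 'g::ab_group_add \<Rightarrow> 'g) \<Rightarrow> ('q \<Rightarrow> 'g set) \<Rightarrow> ('q \<Rightarrow> int) \<Rightarrow> 'g set" where
  "n_plus scale gr \<pi> = module.span scale (\<Union>\<alpha>\<in>{\<alpha>. \<pi> \<alpha> > 0}. gr \<alpha>)"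

definition b_minus ::
    "(complex \<Rightarrow> 'g::ab_group_add \<Rightarrow> 'g) \<Rightarrow> ('q \<Rightarrow> 'g set) \<Rightarrow> ('q \<Rightarrow> int) \<Rightarrow> 'g set" where
  "b_minus scale gr \<pi> = module.span scale (\<Union>\<alpha>\<in>{\<alpha>. \<pi> \<alpha> \<le> 0}. gr \<alpha>)"

definition center_minus ::
    "(complex \<Rightarrow> 'g::ab_group_add \<Rightarrow> 'g) \<Rightarrow> ('g \<Rightarrow> 'g \<Rightarrow> 'g) \<Rightarrow> ('q \<Rightarrow> 'g set) \<Rightarrow> ('q \<Rightarrow> int)
      \<Rightarrow> 'g set" where
  "center_minus scale bracket gr \<pi> = lie_center bracket \<inter> b_minus scale gr \<pi>"

text \<open>Homomorphisms from the Lie subalgebra \<open>S\<close> to the abelian Lie algebra of complex numbers;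
  the values of \<open>\<phi>\<close> outside \<open>S\<close> are irrelevant.\<close>

definition lie_character ::
    "(complex \<Rightarrow> 'g::ab_group_add \<Rightarrow> 'g) \<Rightarrow> ('g \<Rightarrow> 'g \<Rightarrow> 'g) \<Rightarrow> 'g set \<Rightarrow> ('g \<Rightarrow> complex) \<Rightarrow> bool" where
  "lie_character scale bracket S \<phi> \<longleftrightarrow>
     (\<forall>x\<in>S. \<forall>y\<in>S. \<phi> (x + y) = \<phi> x + \<phi> y) \<and>
     (\<forall>c. \<forall>x\<in>S. \<phi> (scale c x) = c * \<phi> x) \<and>
     (\<forall>x\<in>S. \<forall>y\<in>S. \<phi> (bracket x y) = 0)"


section \<open>Enveloping and symmetric algebras\<close>

text \<open>Words under concatenation form a monoid, written additively so that the convolution product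
  on \<^typ>\<open>'a \<Rightarrow>\<^sub>0 'b\<close> makes the finitely supported functions on words the free unital algebra.\<close>

datatype 'a fword = FWord (letters: "'a list")

instantiation fword :: (type) monoid_add
begin
definition "0 = FWord []"
definition "v + w = FWord (letters v @ letters w)"
instance by standard (simp_all add: zero_fword_def plus_fword_def)
end

type_synonym 'g free_elem = "'g fword \<Rightarrow>\<^sub>0 complex"

definition gen :: "'g \<Rightarrow> 'g free_elem" where
  "gen x = Poly_Mapping.single (FWord [x]) 1"

definition scalar :: "complex \<Rightarrow> 'g free_elem" where
  "scalar c = Poly_Mapping.single 0 c"

definition free_alg :: "'g set \<Rightarrow> 'g free_elem ring" where
  "free_alg S =
     ring_of_type_algebra\<lparr>carrier := {p. \<forall>w\<in>Poly_Mapping.keys p. set (letters w) \<subseteq> S}\<rparr>"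

text \<open>Modulo the following relations the free algebra on the set \<open>S\<close> becomes the tensor algebra of
  the vector space \<open>S\<close>.\<close>

definition linear_rels ::
    "(complex \<Rightarrow> 'g::ab_group_add \<Rightarrow> 'g) \<Rightarrow> 'g set \<Rightarrow> 'g free_elem set" where
  "linear_rels scale S =
     {gen (x + y) - gen x - gen y | x y. x \<in> S \<and> y \<in> S} \<union>
     {gen (scale c x) - scalar c * gen x | c x. x \<in> S}"

definition env_ideal ::
    "(complex \<Rightarrow> 'g::ab_group_add \<Rightarrow> 'g) \<Rightarrow> ('g \<Rightarrow> 'g \<Rightarrow> 'g) \<Rightarrow> 'g set \<Rightarrow> 'g free_elem set" where
  "env_ideal scale bracket S = Idl\<^bsub>free_alg S\<^esub> (linear_rels scale S \<union>
     {gen x * gen y - gen y * gen x - gen (bracket x y) | x y. x \<in> S \<and> y \<in> S})"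

text \<open>\<open>U(S)\<close> for a Lie subalgebra \<open>S\<close> of the ambient Lie algebra.\<close>

definition env_alg ::
    "(complex \<Rightarrow> 'g::ab_group_add \<Rightarrow> 'g) \<Rightarrow> ('g \<Rightarrow> 'g \<Rightarrow> 'g) \<Rightarrow> 'g set \<Rightarrow> 'g free_elem set ring" where
  "env_alg scale bracket S = free_alg S Quot env_ideal scale bracket S"

definition sym_alg ::
    "(complex \<Rightarrow> 'g::ab_group_add \<Rightarrow> 'g) \<Rightarrow> 'g set \<Rightarrow> 'g free_elem set ring" where
  "sym_alg scale S = free_alg S Quot (Idl\<^bsub>free_alg S\<^esub> (linear_rels scale S \<union>
     {gen x * gen y - gen y * gen x | x y. x \<in> S \<and> y \<in> S}))"

definition env_class ::
    "(complex \<Rightarrow> 'g::ab_group_add \<Rightarrow> 'g) \<Rightarrow> ('g \<Rightarrow> 'g \<Rightarrow> 'g) \<Rightarrow> 'g free_elem \<Rightarrow> 'g free_elem set" where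
  "env_class scale bracket p = env_ideal scale bracket UNIV +>\<^bsub>free_alg UNIV\<^esub> p"

text \<open>The homomorphisms \<open>U(S) \<rightarrow> U(\<gg>)\<close>, for a subalgebra \<open>S\<close>, and \<open>S(C) \<rightarrow> U(\<gg>)\<close>, for a central
  subspace \<open>C\<close>, that are induced by the inclusion into \<open>\<gg>\<close>.  They send the class of \<open>p\<close> to the
  class of \<open>p\<close>, and are injective by the Poincare-Birkhoff-Witt theorem.\<close>

definition env_incl ::
    "(complex \<Rightarrow> 'g::ab_group_add \<Rightarrow> 'g) \<Rightarrow> ('g \<Rightarrow> 'g \<Rightarrow> 'g) \<Rightarrow> 'g free_elem set \<Rightarrow> 'g free_elem set"
  where
  "env_incl scale bracket Y = (\<Union>p\<in>Y. env_class scale bracket p)"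


section \<open>Whittaker modules\<close>

text \<open>The extension of \<open>\<phi>\<close> to a unital algebra homomorphism on the free algebra, and the map it
  induces on classes (on each class of \<open>U(\<nn>)\<close> the former is constant).\<close>

definition free_eval :: "('g \<Rightarrow> complex) \<Rightarrow> 'g free_elem \<Rightarrow> complex" where
  "free_eval \<phi> p =
     (\<Sum>w\<in>Poly_Mapping.keys p. Poly_Mapping.lookup p w * prod_list (map \<phi> (letters w)))"

definition env_eval :: "('g \<Rightarrow> complex) \<Rightarrow> 'g free_elem set \<Rightarrow> complex" where
  "env_eval \<phi> Y = the_elem (free_eval \<phi> ` Y)"

definition char_module :: "('g \<Rightarrow> complex) \<Rightarrow> ('g free_elem set, complex) module" where
  "char_module \<phi> = mk_module UNIV 0 (+) (\<lambda>Y a. env_eval \<phi> Y * a)"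

type_synonym 'g whittaker_elem = "('g free_elem set \<times> complex \<Rightarrow>\<^sub>0 int) set"

definition whittaker_module ::
    "(complex \<Rightarrow> 'g::ab_group_add \<Rightarrow> 'g) \<Rightarrow> ('g \<Rightarrow> 'g \<Rightarrow> 'g) \<Rightarrow> 'g set \<Rightarrow> ('g \<Rightarrow> complex)
      \<Rightarrow> ('g free_elem set, 'g whittaker_elem) module" where
  "whittaker_module scale bracket n \<phi> =
     tensor_module (env_alg scale bracket UNIV) (env_alg scale bracket n)
       (env_incl scale bracket) (char_module \<phi>)"

text \<open>The additive span \<open>I M\<close> for \<open>I\<close> inside a symmetric algebra \<open>S(C)\<close> acting through \<open>U(\<gg>)\<close>.\<close>

definition ideal_times ::
    "(complex \<Rightarrow> 'g::ab_group_add \<Rightarrow> 'g) \<Rightarrow> ('g \<Rightarrow> 'g \<Rightarrow> 'g) \<Rightarrow> 'g free_elem set set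
      \<Rightarrow> ('g free_elem set, 'm) module \<Rightarrow> 'm set" where
  "ideal_times scale bracket I M =
     generate (add_monoid M) {env_incl scale bracket a \<odot>\<^bsub>M\<^esub> m | a m. a \<in> I \<and> m \<in> carrier M}"

text \<open>A representation of a Lie algebra: a complex vector space with an action.\<close>

record ('g, 'm) lie_module = "(complex, 'm) module" +
  act :: "'g \<Rightarrow> 'm \<Rightarrow> 'm"

definition lie_module_of ::
    "(complex \<Rightarrow> 'g::ab_group_add \<Rightarrow> 'g) \<Rightarrow> ('g \<Rightarrow> 'g \<Rightarrow> 'g) \<Rightarrow> ('g free_elem set, 'm) module
      \<Rightarrow> ('g, 'm) lie_module" where
  "lie_module_of scale bracket M =
     \<lparr>carrier = carrier M, monoid.mult = undefined, monoid.one = undefined,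
      ring.zero = \<zero>\<^bsub>M\<^esub>, ring.add = add M,
      module.smult = (\<lambda>c m. env_class scale bracket (scalar c) \<odot>\<^bsub>M\<^esub> m),
      act = (\<lambda>x m. env_class scale bracket (gen x) \<odot>\<^bsub>M\<^esub> m)\<rparr>"

definition lie_submodule :: "'m set \<Rightarrow> ('g, 'm) lie_module \<Rightarrow> bool" where
  "lie_submodule W V \<longleftrightarrow>
     submodule W (ring_of_type_algebra :: complex ring) V \<and> (\<forall>x. \<forall>w\<in>W. act V x w \<in> W)"

definition whittaker_vector :: "'g set \<Rightarrow> ('g \<Rightarrow> complex) \<Rightarrow> ('g, 'm) lie_module \<Rightarrow> 'm \<Rightarrow> bool" where
  "whittaker_vector n \<phi> V v \<longleftrightarrow> v \<in> carrier V \<and> (\<forall>x\<in>n. act V x v = \<phi> x \<odot>\<^bsub>V\<^esub> v)"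

end

theory Submission
  imports Defs
begin

text \<open>
  The module \<open>V\<close> is cyclic, generated by the image \<open>v\<close> of \<open>1 \<otimes> 1\<close>.  Give a homogeneous \<open>y\<close> of
  degree \<open>\<alpha>\<close> with \<open>\<pi> \<alpha> \<le> 0\<close> the weight \<open>1 - \<pi> \<alpha> \<ge> 1\<close>, and let \<open>F\<^sub>k\<close> be spanned by the
  \<open>y\<^sub>1 \<dots> y\<^sub>m v\<close> of total weight less than \<open>k\<close>, so that \<open>F\<^sub>0 = 0\<close>.  Commuting a homogeneous
  \<open>x \<in> \<nn>\<close> past such a product shows that \<open>x - \<phi> x\<close> maps \<open>F\<^sub>k\<close> into \<open>F\<^bsub>k-1\<^esub>\<close>; in particular
  the \<open>F\<^sub>k\<close> exhaust \<open>V\<close>.  If \<open>k\<close> is minimal with \<open>W \<inter> F\<^sub>k \<noteq> 0\<close>, then every nonzero vector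
  of \<open>W \<inter> F\<^sub>k\<close> is a Whittaker vector.  The filtration is built on the preimage of \<open>V\<close> in the
  free algebra, where it starts from the annihilator \<open>L\<close> of \<open>v\<close>.
\<close>

section \<open>The weight filtration\<close>

text \<open>The bound \<open>K\<close> on the support lets one rule serve the free algebra on a
  subset of the letters, where \<open>K\<close> is the set of words in those letters, as well as the
  whole free algebra.\<close>

lemma poly_mapping_single_induct [consumes 1, case_names zero single add]:
  fixes p :: "'a \<Rightarrow>\<^sub>0 'b::comm_monoid_add"
  assumes "Poly_Mapping.keys p \<subseteq> K"
    and zero: "P 0"
    and single: "\<And>w c. w \<in> K \<Longrightarrow> P (Poly_Mapping.single w c)"
    and add: "\<And>p q. P p \<Longrightarrow> P q \<Longrightarrow> P (p + q)"
  shows "P p"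
proof -
  have "p = (\<Sum>w\<in>Poly_Mapping.keys p. Poly_Mapping.single w (Poly_Mapping.lookup p w))"
    by (rule poly_mapping_eqI) (auto simp: lookup_sum lookup_single when_def in_keys_iff)
  moreover have "P (\<Sum>w\<in>A. Poly_Mapping.single w (Poly_Mapping.lookup p w))"
    if "finite A" "A \<subseteq> K" for A
    using that by induction (use zero single add in simp_all)
  ultimately show ?thesis using assms(1) by (metis finite_keys)
qed

lemma scalar_mult_commute: "scalar c * p = p * scalar c"
  using subset_UNIV
  by (induction p rule: poly_mapping_single_induct)
    (simp_all add: scalar_def mult_single mult.commute distrib_left distrib_right)

text \<open>In the application \<open>L\<close> is the annihilator, in the free algebra, of the
  cyclic generator of \<open>M/IM\<close>. Since \<open>L\<close> is only a left ideal, the three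
  families of relations carry a factor \<open>q\<close> on the right; together with
  \<open>L_mult\<close> this places the two-sided ideal defining the enveloping algebra inside
  \<open>L\<close>.\<close>

locale whittaker_left_ideal = graded_lie_algebra scale bracket gr
  for scale :: "complex \<Rightarrow> 'g::ab_group_add \<Rightarrow> 'g" and bracket :: "'g \<Rightarrow> 'g \<Rightarrow> 'g"
    and gr :: "'q::linordered_ab_group_add \<Rightarrow> 'g set" +
  fixes \<pi> :: "'q \<Rightarrow> int" and \<phi> :: "'g \<Rightarrow> complex" and L :: "'g free_elem set"
  assumes pi_add: "\<pi> (\<alpha> + \<beta>) = \<pi> \<alpha> + \<pi> \<beta>"
    and character: "lie_character scale bracket (n_plus scale gr \<pi>) \<phi>"
    and L_add: "p \<in> L \<Longrightarrow> q \<in> L \<Longrightarrow> p + q \<in> L"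
    and L_mult: "p \<in> L \<Longrightarrow> q * p \<in> L"
    and L_gen_add: "(gen (x + y) - gen x - gen y) * q \<in> L"
    and L_gen_scale: "(gen (scale c x) - scalar c * gen x) * q \<in> L"
    and L_gen_bracket: "(gen x * gen y - gen y * gen x - gen (bracket x y)) * q \<in> L"
    and L_character: "x \<in> n_plus scale gr \<pi> \<Longrightarrow> gen x - scalar (\<phi> x) \<in> L"
begin

lemma gr_n_plus: "x \<in> gr \<alpha> \<Longrightarrow> 0 < \<pi> \<alpha> \<Longrightarrow> x \<in> n_plus scale gr \<pi>"
  unfolding n_plus_def by (intro span_base) blast

text \<open>Step \<open>0\<close> is \<open>L\<close> itself, so that the generator \<open>1\<close> first appears in step \<open>1\<close>.\<close>

inductive filt :: "nat \<Rightarrow> 'g free_elem \<Rightarrow> bool" where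
  ideal: "p \<in> L \<Longrightarrow> filt k p"
| one: "filt (Suc k) 1"
| add: "filt k p \<Longrightarrow> filt k q \<Longrightarrow> filt k (p + q)"
| scal: "filt k p \<Longrightarrow> filt k (scalar c * p)"
| low: "filt k p \<Longrightarrow> y \<in> gr \<alpha> \<Longrightarrow> \<pi> \<alpha> \<le> 0 \<Longrightarrow> filt (k + nat (1 - \<pi> \<alpha>)) (gen y * p)"

lemma filt_Suc: "filt k p \<Longrightarrow> filt (Suc k) p"
proof (induction rule: filt.induct)
  case (low k p y \<alpha>)
  then show ?case using filt.low[of "Suc k" p y \<alpha>] by simp
qed (auto intro: filt.intros)

lemma filt_mono: "k \<le> l \<Longrightarrow> filt k p \<Longrightarrow> filt l p"
  by (induction l rule: dec_induct) (auto intro: filt_Suc)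

text \<open>The rule \<open>one\<close> starts at index 1 and \<open>low\<close> raises the index by
  at least 1. At index 0 only \<open>ideal\<close>, \<open>add\<close> and \<open>scal\<close>
  remain, and \<open>L\<close> is closed under them.\<close>

lemma filt_0: "filt 0 p \<Longrightarrow> p \<in> L"
  by (induction "0::nat" p rule: filt.induct) (auto intro: L_add L_mult)

text \<open>Modulo \<open>L\<close>, (x - \<phi> x) y p = [x,y] p + y (x - \<phi> x) p. The last
  term drops by the induction hypothesis for \<open>p\<close>. The degree of [x,y] has a larger
  value of \<pi> than that of y, so either [x,y] weighs less than y, or it lies in
  \<open>n_plus\<close> and does not raise the index of \<open>p\<close> at all. The induction is
  over arbitrary x because the hypothesis is also applied to [x,y].\<close>

lemma filt_lower:
  assumes "filt k p" "x \<in> gr \<beta>" "0 < \<pi> \<beta>"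
  shows "filt (k - 1) ((gen x - scalar (\<phi> x)) * p)"
  using assms
proof (induction arbitrary: x \<beta> rule: filt.induct)
  case (ideal p k)
  then show ?case by (intro filt.ideal L_mult)
next
  case (one k)
  then show ?case using L_character gr_n_plus by (auto intro: filt.ideal)
next
  case (add k p q)
  then show ?case by (auto simp: distrib_left intro: filt.add)
next
  case (scal k p c)
  have "(gen x - scalar (\<phi> x)) * (scalar c * p) = scalar c * ((gen x - scalar (\<phi> x)) * p)"
    by (metis mult.assoc scalar_mult_commute)
  with scal show ?case by (auto intro: filt.scal)
next
  case (low k p y \<alpha>)
  show ?case
  proof (cases k)
    \<comment> \<open>Subtraction truncates, so at index 0 the induction hypothesis yields no drop;
      but then \<open>p\<close> already lies in the left ideal \<open>L\<close>.\<close>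
    case 0
    then show ?thesis using low.hyps filt_0 by (auto intro!: filt.ideal L_mult)
  next
    case (Suc l)
    define w where "w = nat (1 - \<pi> \<alpha>)"
    have xy: "bracket x y \<in> gr (\<beta> + \<alpha>)" using low gr_bracket by blast
    have br: "filt (l + w) (gen (bracket x y) * p)"
    proof (cases "0 < \<pi> (\<beta> + \<alpha>)")
      case True
      \<comment> \<open>Since y is not in positive degree, \<phi> [x,y] can be nonzero, and the
        scalar term only stays in step \<open>k\<close>. This suffices: \<open>k\<close> is
        \<open>Suc l\<close> and \<open>w\<close> is at least 1.\<close>
      have "filt l ((gen (bracket x y) - scalar (\<phi> (bracket x y))) * p)"
        using low.IH[OF xy True] Suc by simp
      then have "filt k ((gen (bracket x y) - scalar (\<phi> (bracket x y))) * p)"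
        using Suc filt_Suc by simp
      from filt.add[OF this filt.scal[OF low.hyps(1)], of "\<phi> (bracket x y)"]
      have "filt k (gen (bracket x y) * p)" by (simp add: algebra_simps)
      then show ?thesis by (rule filt_mono[rotated]) (use Suc low in \<open>simp add: w_def\<close>)
    next
      case False
      \<comment> \<open>As \<pi> \<beta> is a positive integer, the weight of [x,y] is at most
        \<open>w - 1\<close>, which makes up for \<open>k\<close> being
        \<open>Suc l\<close>.\<close>
      then have "filt (k + nat (1 - \<pi> (\<beta> + \<alpha>))) (gen (bracket x y) * p)"
        using low.hyps xy by (intro filt.low) auto
      then show ?thesis
        by (rule filt_mono[rotated]) (use Suc low False in \<open>simp add: w_def pi_add\<close>)
    qed
    have tail: "filt (l + w) (gen y * ((gen x - scalar (\<phi> x)) * p))"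
      unfolding w_def using low.IH[OF low.prems] low.hyps Suc by (intro filt.low) auto
    have "(gen x - scalar (\<phi> x)) * (gen y * p) =
        (gen x * gen y - gen y * gen x - gen (bracket x y)) * p
        + (gen (bracket x y) * p + gen y * ((gen x - scalar (\<phi> x)) * p))"
      by (simp add: algebra_simps scalar_mult_commute)
    then show ?thesis
      using filt.add[OF filt.ideal[OF L_gen_bracket] filt.add[OF br tail]] Suc
      by (simp add: w_def)
  qed
qed

text \<open>By additivity of \<open>gen\<close> modulo \<open>L\<close> it is enough to treat
  homogeneous x. In nonpositive degree this is the rule \<open>low\<close>; in positive degree x p =
  (x - \<phi> x) p + \<phi>(x) p, where neither summand leaves the step of \<open>p\<close>.\<close>

lemma filt_gen:
  assumes "filt k p"
  shows "\<exists>l. filt l (gen x * p)"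
proof -
  let ?E = "{x. \<exists>l. filt l (gen x * p)}"
  have add: "x + y \<in> ?E" if xy: "x \<in> ?E" "y \<in> ?E" for x y
  proof -
    obtain l m where "filt l (gen x * p)" "filt m (gen y * p)" using xy by blast
    then have "filt (max l m) (gen x * p + gen y * p)"
      by (intro filt.add) (auto intro: filt_mono[rotated])
    from filt.add[OF this filt.ideal[OF L_gen_add[of x y p]]]
    show ?thesis by (auto simp: algebra_simps)
  qed
  have gr: "x \<in> ?E" if x: "x \<in> gr \<alpha>" for x \<alpha>
  proof (cases "0 < \<pi> \<alpha>")
    case True
    have "filt k ((gen x - scalar (\<phi> x)) * p)"
      using filt_lower[OF assms x True] by (rule filt_mono[rotated]) simp
    from filt.add[OF this filt.scal[OF assms, of "\<phi> x"]] show ?thesis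
      by (auto simp: algebra_simps)
  next
    case False
    then show ?thesis using filt.low[OF assms x] by auto
  qed
  have zero: "0 \<in> ?E" using gr[of 0] gr_subspace subspace_0 by blast
  obtain c where c: "\<And>\<alpha>. Poly_Mapping.lookup c \<alpha> \<in> gr \<alpha>"
    "x = (\<Sum>\<alpha>\<in>Poly_Mapping.keys c. Poly_Mapping.lookup c \<alpha>)"
    using gr_direct_sum[of x] by blast
  have "(\<Sum>\<alpha>\<in>K. Poly_Mapping.lookup c \<alpha>) \<in> ?E" if "finite K" for K
    using that by induction (use zero add gr[OF c(1)] in \<open>simp_all del: mem_Collect_eq\<close>)
  then show ?thesis using c(2) by auto
qed

text \<open>Every word arises from 1 by prepending letters, each of which reaches some finite step;
  a sum lies in the larger of the steps of its summands.\<close>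

lemma filt_exhaustive: "\<exists>k. filt k p"
proof -
  have word: "\<exists>k. filt k (Poly_Mapping.single (FWord xs) c)" for xs c
  proof -
    have "\<exists>k. filt k (Poly_Mapping.single (FWord xs) 1)"
    proof (induction xs)
      case Nil
      have "Poly_Mapping.single (FWord []) 1 = (1 :: 'g free_elem)"
        by (metis single_one zero_fword_def)
      then show ?case using filt.one by metis
    next
      case (Cons x xs)
      have "Poly_Mapping.single (FWord (x # xs)) 1 = gen x * Poly_Mapping.single (FWord xs) 1"
        by (simp add: gen_def mult_single plus_fword_def)
      with Cons filt_gen show ?case by metis
    qed
    moreover have "Poly_Mapping.single (FWord xs) c = scalar c * Poly_Mapping.single (FWord xs) 1"
      by (simp add: scalar_def mult_single)
    ultimately show ?thesis by (metis filt.scal)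
  qed
  show ?thesis
    using subset_UNIV
  proof (induction p rule: poly_mapping_single_induct)
    case zero
    then show ?case using filt.scal[OF filt.one, of _ 0] by (auto simp: scalar_def)
  next
    case (single w c)
    then show ?case using word by (cases w) simp
  next
    case (add p q)
    then obtain k l where "filt k p" "filt l q" by blast
    then have "filt (max k l) (p + q)"
      by (intro filt.add) (auto intro: filt_mono[rotated])
    then show ?case ..
  qed
qed

text \<open>Here \<open>W\<close> is the preimage of a submodule. An element of \<open>W\<close>
  outside \<open>L\<close> of least index is pushed by x - \<phi> x into an earlier step while
  staying in \<open>W\<close>, so by minimality it lands in \<open>L\<close>.\<close>

lemma whittaker_exists:
  assumes "p \<in> W" "p \<notin> L" and W: "\<And>q p. p \<in> W \<Longrightarrow> q * p \<in> W"
  shows "\<exists>p\<in>W. p \<notin> L \<and> (\<forall>x\<in>n_plus scale gr \<pi>. (gen x - scalar (\<phi> x)) * p \<in> L)"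
proof -
  let ?P = "\<lambda>k. \<exists>p\<in>W. p \<notin> L \<and> filt k p"
  define k where "k = (LEAST k. ?P k)"
  have "\<exists>k. ?P k" using assms filt_exhaustive by blast
  then have "?P k" unfolding k_def by (rule LeastI_ex)
  then obtain p where p: "p \<in> W" "p \<notin> L" "filt k p" by blast
  \<comment> \<open>Step 0 is contained in \<open>L\<close>, so \<open>k - 1\<close> is genuinely
    smaller than the minimum \<open>k\<close>.\<close>
  then have "k \<noteq> 0" using filt_0 by metis
  then have "\<not> ?P (k - 1)" using not_less_Least[of "k - 1" ?P] unfolding k_def by simp
  then have hom: "(gen x - scalar (\<phi> x)) * p \<in> L" if "x \<in> gr \<beta>" "0 < \<pi> \<beta>" for x \<beta>
    using filt_lower[OF p(3) that] W[OF p(1)] by blast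
  let ?n = "n_plus scale gr \<pi>"
  \<comment> \<open>Minimality handles homogeneous x only. The set of x that satisfy the claim is a
    subspace, by linearity of \<phi> and the linear relations modulo \<open>L\<close>, and hence
    contains the span \<open>n_plus\<close>.\<close>
  let ?S = "{x \<in> ?n. (gen x - scalar (\<phi> x)) * p \<in> L}"
  have sub: "subspace ?n" unfolding n_plus_def by (rule subspace_span)
  have phi: "\<phi> (x + y) = \<phi> x + \<phi> y" "\<phi> (scale c x) = c * \<phi> x" if "x \<in> ?n" "y \<in> ?n" for x y c
    using character that unfolding lie_character_def by auto
  have scalar_add: "scalar (a + b) = scalar a + scalar b" for a b
    by (simp add: scalar_def single_add)
  have scalar_mult: "scalar (a * b) = scalar a * scalar b" for a b
    by (simp add: scalar_def mult_single)
  have S_scale: "scale c x \<in> ?S" if x: "x \<in> ?S" for c x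
  proof -
    have "(gen (scale c x) - scalar (\<phi> (scale c x))) * p =
      (gen (scale c x) - scalar c * gen x) * p + scalar c * ((gen x - scalar (\<phi> x)) * p)"
      using x phi(2)[of x x c] by (simp add: scalar_mult algebra_simps)
    then show ?thesis using x L_add[OF L_gen_scale L_mult] subspace_scale[OF sub] by auto
  qed
  have "subspace ?S"
  proof (rule subspaceI)
    show "0 \<in> ?S"
    proof -
      have z: "\<phi> 0 = 0" using phi(2)[of 0 0 0] subspace_0[OF sub] by simp
      have "gen 0 * p \<in> L" using L_gen_scale[of 0 0 p] by (simp add: scalar_def)
      then show ?thesis using subspace_0[OF sub] z by (simp add: scalar_def)
    qed
    show "x + y \<in> ?S" if x: "x \<in> ?S" "y \<in> ?S" for x y
    proof -
      have "(gen (x + y) - scalar (\<phi> (x + y))) * p = (gen (x + y) - gen x - gen y) * p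
        + ((gen x - scalar (\<phi> x)) * p + (gen y - scalar (\<phi> y)) * p)"
        using x phi by (simp add: scalar_add algebra_simps)
      then show ?thesis using x L_add[OF L_gen_add L_add] subspace_add[OF sub] by auto
    qed
  qed (rule S_scale)
  moreover have "(\<Union>\<alpha>\<in>{\<alpha>. \<pi> \<alpha> > 0}. gr \<alpha>) \<subseteq> ?S" using hom gr_n_plus by auto
  ultimately have "?n \<subseteq> ?S" unfolding n_plus_def by (intro span_minimal)
  then show ?thesis using p by blast
qed

end

section \<open>Modules of cosets and tensor products\<close>

locale left_module = ring U + M: abelian_group M
  for U :: "('u, 'a) ring_scheme" (structure) and M :: "('u, 'm) module" +
  assumes smult_closed [simp, intro]:
      "u \<in> carrier U \<Longrightarrow> x \<in> carrier M \<Longrightarrow> u \<odot>\<^bsub>M\<^esub> x \<in> carrier M"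
    and smult_l_distr:
      "u \<in> carrier U \<Longrightarrow> v \<in> carrier U \<Longrightarrow> x \<in> carrier M \<Longrightarrow>
        (u \<oplus> v) \<odot>\<^bsub>M\<^esub> x = u \<odot>\<^bsub>M\<^esub> x \<oplus>\<^bsub>M\<^esub> v \<odot>\<^bsub>M\<^esub> x"
    and smult_r_distr:
      "u \<in> carrier U \<Longrightarrow> x \<in> carrier M \<Longrightarrow> y \<in> carrier M \<Longrightarrow>
        u \<odot>\<^bsub>M\<^esub> (x \<oplus>\<^bsub>M\<^esub> y) = u \<odot>\<^bsub>M\<^esub> x \<oplus>\<^bsub>M\<^esub> u \<odot>\<^bsub>M\<^esub> y"
    and smult_assoc:
      "u \<in> carrier U \<Longrightarrow> v \<in> carrier U \<Longrightarrow> x \<in> carrier M \<Longrightarrow>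
        (u \<otimes> v) \<odot>\<^bsub>M\<^esub> x = u \<odot>\<^bsub>M\<^esub> (v \<odot>\<^bsub>M\<^esub> x)"
    and smult_one [simp]: "x \<in> carrier M \<Longrightarrow> \<one> \<odot>\<^bsub>M\<^esub> x = x"
begin

lemma smult_hom: "u \<in> carrier U \<Longrightarrow> (\<lambda>x. u \<odot>\<^bsub>M\<^esub> x) \<in> hom (add_monoid M) (add_monoid M)"
  by (rule homI) (auto simp: smult_r_distr)

lemma smult_r_null [simp]: "u \<in> carrier U \<Longrightarrow> u \<odot>\<^bsub>M\<^esub> \<zero>\<^bsub>M\<^esub> = \<zero>\<^bsub>M\<^esub>"
  using smult_r_distr[of u "\<zero>\<^bsub>M\<^esub>" "\<zero>\<^bsub>M\<^esub>"] by (simp add: M.add.l_cancel_one)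

lemma smult_l_null [simp]: "x \<in> carrier M \<Longrightarrow> \<zero> \<odot>\<^bsub>M\<^esub> x = \<zero>\<^bsub>M\<^esub>"
  using smult_l_distr[of "\<zero>" "\<zero>" x] by (simp add: M.add.l_cancel_one)

lemma smult_r_minus:
  "u \<in> carrier U \<Longrightarrow> x \<in> carrier M \<Longrightarrow> u \<odot>\<^bsub>M\<^esub> (\<ominus>\<^bsub>M\<^esub> x) = \<ominus>\<^bsub>M\<^esub> (u \<odot>\<^bsub>M\<^esub> x)"
  using smult_r_distr[of u "\<ominus>\<^bsub>M\<^esub> x" x] by (simp add: M.l_neg M.minus_equality)

text \<open>Shows that \<open>IM\<close> is a submodule: its generators a m form a set stable under
  the scalars, and stability passes to sums and negatives.\<close>

lemma generate_smult_closed: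
  assumes "B \<subseteq> carrier M" "u \<in> carrier U" "\<And>x. x \<in> B \<Longrightarrow> u \<odot>\<^bsub>M\<^esub> x \<in> B"
    and "y \<in> generate (add_monoid M) B"
  shows "u \<odot>\<^bsub>M\<^esub> y \<in> generate (add_monoid M) B"
  using assms(4)
proof induction
  case one
  then show ?case using assms(2) generate.one[of "add_monoid M" B] by simp
next
  case (incl x)
  then show ?case using assms(3) by (intro generate.incl)
next
  case (inv x)
  then have "u \<odot>\<^bsub>M\<^esub> (\<ominus>\<^bsub>M\<^esub> x) = \<ominus>\<^bsub>M\<^esub> (u \<odot>\<^bsub>M\<^esub> x)" using assms(1,2) by (intro smult_r_minus) auto
  then show ?case
    using generate.inv[of "u \<odot>\<^bsub>M\<^esub> x" B "add_monoid M"] assms(3) inv by (simp add: a_inv_def)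
next
  case (eng x y)
  then have "x \<in> carrier M" "y \<in> carrier M"
    using M.add.generate_in_carrier[OF assms(1)] by auto
  then show ?case
    using generate.eng[OF eng.IH] assms(2) smult_r_distr by simp
qed

end

text \<open>The scalar action on a quotient is defined as a union over all representatives. Since
  \<open>f\<close> preserves \<open>H\<close>, the representatives of one coset have images in one
  coset, so the union collapses to it.\<close>

lemma (in group) UN_rcoset_hom:
  assumes "subgroup H G" "f \<in> hom G G" "f ` H \<subseteq> H" "x \<in> carrier G"
  shows "(\<Union>y\<in>H #> x. H #> f y) = H #> f x"
proof -
  have "H #> f y = H #> f x" if y: "y \<in> H #> x" for y
  proof -
    obtain h where h: "h \<in> H" "y = h \<otimes> x" using y unfolding r_coset_def by blast
    then have "f y = f h \<otimes> f x"
      using assms hom_mult[OF assms(2)] subgroup.mem_carrier by metis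
    then have "f y \<in> H #> f x" using h assms(3) unfolding r_coset_def by blast
    then show ?thesis using repr_independence assms hom_in_carrier by metis
  qed
  then show ?thesis using rcos_self[OF assms(4,1)] by blast
qed

text \<open>The group axioms read only three fields. This carries the factor group over to the
  record shape of \<open>add_monoid\<close>, which has a further slot.\<close>

lemma comm_group_extend:
  assumes "comm_group \<lparr>carrier = C, monoid.mult = f, one = e\<rparr>"
  shows "comm_group \<lparr>carrier = C, monoid.mult = f, one = e, \<dots> = m\<rparr>"
proof -
  interpret G: comm_group "\<lparr>carrier = C, monoid.mult = f, one = e\<rparr>" by fact
  show ?thesis
    using G.m_closed G.one_closed G.m_assoc G.m_comm G.l_one G.l_inv_ex
    by (intro comm_groupI) auto
qed

text \<open>Common form of a quotient \<open>M/N\<close> and of a tensor product, the latter being a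
  free abelian group modulo its relations, so that the module laws are proved once.\<close>

definition coset_module ::
    "('m, 'b) monoid_scheme \<Rightarrow> 'm set \<Rightarrow> ('u \<Rightarrow> 'm \<Rightarrow> 'm) \<Rightarrow> ('u, 'm set) module" where
  "coset_module G H s =
     mk_module (rcosets\<^bsub>G\<^esub> H) H (set_mult G) (\<lambda>u Y. \<Union>x\<in>Y. H #>\<^bsub>G\<^esub> s u x)"

lemma coset_module_simps [simp]:
  "carrier (coset_module G H s) = rcosets\<^bsub>G\<^esub> H"
  "\<zero>\<^bsub>coset_module G H s\<^esub> = H"
  "add (coset_module G H s) = set_mult G"
  by (simp_all add: coset_module_def mk_module_def)

lemma coset_module_smult:
  assumes "group G" "subgroup H G" "s u \<in> hom G G" "s u ` H \<subseteq> H" "x \<in> carrier G"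
  shows "u \<odot>\<^bsub>coset_module G H s\<^esub> (H #>\<^bsub>G\<^esub> x) = H #>\<^bsub>G\<^esub> s u x"
  using group.UN_rcoset_hom[OF assms] by (simp add: coset_module_def mk_module_def)

text \<open>The laws in the scalar are required modulo \<open>H\<close> because additivity fails in
  the free abelian group underlying a tensor product and appears only after dividing by the
  relations.\<close>

lemma left_module_coset_module:
  fixes G (structure)
  assumes "ring U" "comm_group G" "subgroup H G"
    and hom: "\<And>u. u \<in> carrier U \<Longrightarrow> s u \<in> hom G G"
    and stable: "\<And>u. u \<in> carrier U \<Longrightarrow> s u ` H \<subseteq> H"
    and add: "\<And>u v x. u \<in> carrier U \<Longrightarrow> v \<in> carrier U \<Longrightarrow> x \<in> carrier G \<Longrightarrow>
      H #>\<^bsub>G\<^esub> s (u \<oplus>\<^bsub>U\<^esub> v) x = H #>\<^bsub>G\<^esub> (s u x \<otimes>\<^bsub>G\<^esub> s v x)"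
    and mult: "\<And>u v x. u \<in> carrier U \<Longrightarrow> v \<in> carrier U \<Longrightarrow> x \<in> carrier G \<Longrightarrow>
      H #>\<^bsub>G\<^esub> s (u \<otimes>\<^bsub>U\<^esub> v) x = H #>\<^bsub>G\<^esub> s u (s v x)"
    and one: "\<And>x. x \<in> carrier G \<Longrightarrow> H #>\<^bsub>G\<^esub> s \<one>\<^bsub>U\<^esub> x = H #>\<^bsub>G\<^esub> x"
  shows "left_module U (coset_module G H s)"
proof -
  interpret U: ring U by fact
  interpret G: comm_group G by fact
  interpret H: normal H G using assms(3) by (rule G.subgroup_imp_normal)
  let ?M = "coset_module G H s"
  note sm = coset_module_smult[OF G.is_group assms(3) hom stable]
  have cl: "s u x \<in> carrier G" if "u \<in> carrier U" "x \<in> carrier G" for u x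
    using hom[OF that(1)] that(2) by (rule hom_in_carrier)
  have reps: "\<exists>x\<in>carrier G. Y = H #> x" if "Y \<in> carrier ?M" for Y
    using that by (auto simp: RCOSETS_def)
  show ?thesis
  proof (intro left_module.intro left_module_axioms.intro U.ring_axioms)
    have "comm_group \<lparr>carrier = rcosets H, monoid.mult = (<#>), one = H, \<dots> = undefined\<rparr>"
      using G.abelian_FactGroup[OF assms(3)] unfolding FactGroup_def by (rule comm_group_extend)
    then show "abelian_group ?M"
      by (intro comm_group_abelian_groupI) simp
  next
    fix u Y assume "u \<in> carrier U" "Y \<in> carrier ?M"
    then show "u \<odot>\<^bsub>?M\<^esub> Y \<in> carrier ?M"
      using reps[of Y] by (auto simp: sm cl G.rcosetsI H.subset)
  next
    fix u v Y assume "u \<in> carrier U" "v \<in> carrier U" "Y \<in> carrier ?M"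
    then show "(u \<oplus>\<^bsub>U\<^esub> v) \<odot>\<^bsub>?M\<^esub> Y = u \<odot>\<^bsub>?M\<^esub> Y \<oplus>\<^bsub>?M\<^esub> v \<odot>\<^bsub>?M\<^esub> Y"
      using reps[of Y] by (auto simp: sm cl H.rcos_sum add)
  next
    fix u Y Y' assume "u \<in> carrier U" "Y \<in> carrier ?M" "Y' \<in> carrier ?M"
    then show "u \<odot>\<^bsub>?M\<^esub> (Y \<oplus>\<^bsub>?M\<^esub> Y') = u \<odot>\<^bsub>?M\<^esub> Y \<oplus>\<^bsub>?M\<^esub> u \<odot>\<^bsub>?M\<^esub> Y'"
      using reps[of Y] reps[of Y'] hom_mult[OF hom] by (auto simp: sm cl H.rcos_sum)
  next
    fix u v Y assume "u \<in> carrier U" "v \<in> carrier U" "Y \<in> carrier ?M"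
    then show "(u \<otimes>\<^bsub>U\<^esub> v) \<odot>\<^bsub>?M\<^esub> Y = u \<odot>\<^bsub>?M\<^esub> (v \<odot>\<^bsub>?M\<^esub> Y)"
      using reps[of Y] by (auto simp: sm cl mult)
  next
    fix Y assume "Y \<in> carrier ?M"
    then show "\<one>\<^bsub>U\<^esub> \<odot>\<^bsub>?M\<^esub> Y = Y"
      using reps[of Y] by (auto simp: sm one)
  qed
qed

lemma quot_module_eq_coset_module:
  "quot_module M N = coset_module (add_monoid M) N (module.smult M)"
  by (simp add: quot_module_def coset_module_def A_RCOSETS_def a_r_coset_def set_add_def)

lemma (in left_module)
  assumes "subgroup N (add_monoid M)"
    and "\<And>u x. u \<in> carrier U \<Longrightarrow> x \<in> N \<Longrightarrow> u \<odot>\<^bsub>M\<^esub> x \<in> N"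
  shows left_module_quot_module: "left_module U (quot_module M N)"
    and quot_module_smult: "u \<in> carrier U \<Longrightarrow> x \<in> carrier M \<Longrightarrow>
      u \<odot>\<^bsub>quot_module M N\<^esub> (N +>\<^bsub>M\<^esub> x) = N +>\<^bsub>M\<^esub> (u \<odot>\<^bsub>M\<^esub> x)"
proof -
  have G: "comm_group (add_monoid M)" by (rule M.a_comm_group)
  show "left_module U (quot_module M N)"
    unfolding quot_module_eq_coset_module
    by (rule left_module_coset_module[OF ring_axioms G assms(1) smult_hom])
      (auto simp: assms(2) smult_l_distr smult_assoc)
  show "u \<odot>\<^bsub>quot_module M N\<^esub> (N +>\<^bsub>M\<^esub> x) = N +>\<^bsub>M\<^esub> (u \<odot>\<^bsub>M\<^esub> x)"
    if "u \<in> carrier U" "x \<in> carrier M"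
    unfolding quot_module_eq_coset_module a_r_coset_def
    using that assms(2)
    by (intro coset_module_smult comm_group.axioms(2) G assms(1) smult_hom) auto
qed

lemma free_Abelian_group_rcos_eqI:
  assumes "subgroup H (free_Abelian_group S)" "x \<in> carrier (free_Abelian_group S)"
    "y \<in> carrier (free_Abelian_group S)" "x - y \<in> H"
  shows "H #>\<^bsub>free_Abelian_group S\<^esub> x = H #>\<^bsub>free_Abelian_group S\<^esub> y"
proof -
  have "x \<in> H #>\<^bsub>free_Abelian_group S\<^esub> y"
    using assms(4) by (auto simp: r_coset_def intro!: bexI[of _ "x - y"])
  then show ?thesis
    using group.repr_independence[OF group_free_Abelian_group _ assms(3,1)] by simp
qed

section \<open>Tensor products along a map of scalars\<close>

locale tensor_data = U: ring U
  for U :: "('u, 'a) ring_scheme" and R :: "('r, 'b) ring_scheme" and h :: "'r \<Rightarrow> 'u"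
    and N :: "('r, 'n) module" +
  assumes h_closed: "r \<in> carrier R \<Longrightarrow> h r \<in> carrier U"
    and N_add: "n \<in> carrier N \<Longrightarrow> n' \<in> carrier N \<Longrightarrow> n \<oplus>\<^bsub>N\<^esub> n' \<in> carrier N"
    and N_smult: "r \<in> carrier R \<Longrightarrow> n \<in> carrier N \<Longrightarrow> r \<odot>\<^bsub>N\<^esub> n \<in> carrier N"
begin

definition "F = free_Abelian_group (carrier U \<times> carrier N)"
definition "H = generate F (tensor_rels U R h N)"
definition "tensor_act u = frag_extend (\<lambda>(v, n). frag_of (u \<otimes>\<^bsub>U\<^esub> v, n))"

lemma tensor_module_eq_coset_module: "tensor_module U R h N = coset_module F H tensor_act"
  by (simp add: tensor_module_def coset_module_def Let_def F_def H_def tensor_act_def)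

lemma F_comm_group: "comm_group F"
  unfolding F_def by (rule abelian_free_Abelian_group)

lemma F_simps [simp]: "\<one>\<^bsub>F\<^esub> = 0" "x \<otimes>\<^bsub>F\<^esub> y = x + y"
  "x \<in> carrier F \<longleftrightarrow> Poly_Mapping.keys x \<subseteq> carrier U \<times> carrier N"
  by (simp_all add: F_def)

lemma F_diff: "x \<in> carrier F \<Longrightarrow> y \<in> carrier F \<Longrightarrow> x - y \<in> carrier F"
  using keys_diff[of x y] by auto

lemma tensor_rels_carrier: "tensor_rels U R h N \<subseteq> carrier F"
  unfolding tensor_rels_def
  by (auto simp del: F_simps(3) intro!: F_diff) (auto simp: h_closed N_add N_smult)

lemma H_subgroup: "subgroup H F"
  unfolding H_def
  by (intro group.generate_is_subgroup tensor_rels_carrier comm_group.axioms(2) F_comm_group)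

lemma H_carrier: "x \<in> H \<Longrightarrow> x \<in> carrier F"
  using H_subgroup subgroup.mem_carrier by metis

lemma H_zero [simp]: "0 \<in> H"
  using subgroup.one_closed[OF H_subgroup] by simp

lemma H_add: "x \<in> H \<Longrightarrow> y \<in> H \<Longrightarrow> x + y \<in> H"
  using subgroup.m_closed[OF H_subgroup] by simp

lemma H_minus: "x \<in> H \<Longrightarrow> - x \<in> H"
  using subgroup.m_inv_closed[OF H_subgroup, of x] H_carrier[of x] by (simp add: F_def)

lemma H_diff: "x \<in> H \<Longrightarrow> y \<in> H \<Longrightarrow> x - y \<in> H"
  using H_add[of x "- y"] H_minus[of y] by simp

lemma H_rel: "x \<in> tensor_rels U R h N \<Longrightarrow> x \<in> H"
  unfolding H_def by (rule generate.incl)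

lemma H_add_left: "u \<in> carrier U \<Longrightarrow> v \<in> carrier U \<Longrightarrow> n \<in> carrier N \<Longrightarrow>
    frag_of (u \<oplus>\<^bsub>U\<^esub> v, n) - frag_of (u, n) - frag_of (v, n) \<in> H"
  by (rule H_rel) (auto simp: tensor_rels_def)

lemma H_add_right: "u \<in> carrier U \<Longrightarrow> n \<in> carrier N \<Longrightarrow> n' \<in> carrier N \<Longrightarrow>
    frag_of (u, n \<oplus>\<^bsub>N\<^esub> n') - frag_of (u, n) - frag_of (u, n') \<in> H"
  by (rule H_rel) (auto simp: tensor_rels_def)

lemma H_balanced: "u \<in> carrier U \<Longrightarrow> r \<in> carrier R \<Longrightarrow> n \<in> carrier N \<Longrightarrow>
    frag_of (u \<otimes>\<^bsub>U\<^esub> h r, n) - frag_of (u, r \<odot>\<^bsub>N\<^esub> n) \<in> H"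
  by (rule H_rel) (auto simp: tensor_rels_def)

lemma tensor_act_diff: "tensor_act u (x - y) = tensor_act u x - tensor_act u y"
  by (simp add: tensor_act_def frag_extend_diff)

lemma tensor_act_of [simp]: "tensor_act u (frag_of (v, n)) = frag_of (u \<otimes>\<^bsub>U\<^esub> v, n)"
  by (simp add: tensor_act_def)

lemma tensor_act_zero [simp]: "tensor_act u 0 = 0"
  by (simp add: tensor_act_def)

lemma tensor_act_add: "tensor_act u (x + y) = tensor_act u x + tensor_act u y"
  by (simp add: tensor_act_def frag_extend_add)

lemma F_induct [consumes 1, case_names zero one diff]:
  assumes "x \<in> carrier F" "P 0"
    and "\<And>u n. u \<in> carrier U \<Longrightarrow> n \<in> carrier N \<Longrightarrow> P (frag_of (u, n))"
    and "\<And>x y. x \<in> carrier F \<Longrightarrow> y \<in> carrier F \<Longrightarrow> P x \<Longrightarrow> P y \<Longrightarrow> P (x - y)"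
  shows "P x"
  by (rule free_Abelian_group_induct[of x "carrier U \<times> carrier N"]) (use assms in auto)

lemma tensor_act_carrier:
  assumes "x \<in> carrier F" "u \<in> carrier U"
  shows "tensor_act u x \<in> carrier F"
  using assms(1)
proof (induction x rule: F_induct)
  case (diff x y)
  then show ?case unfolding tensor_act_diff by (intro F_diff)
qed (use assms(2) in auto)

text \<open>Left multiplication by \<open>u\<close> turns each relation into one of the same kind:
  by distributivity for sums in the left factor, by associativity for balancing.\<close>

lemma tensor_act_H:
  assumes "u \<in> carrier U" "x \<in> H"
  shows "tensor_act u x \<in> H"
proof -
  have rel: "tensor_act u x \<in> H" if x: "x \<in> tensor_rels U R h N" for x
  proof -
    consider (left) v v' n where "v \<in> carrier U" "v' \<in> carrier U" "n \<in> carrier N"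
        "x = frag_of (v \<oplus>\<^bsub>U\<^esub> v', n) - frag_of (v, n) - frag_of (v', n)"
      | (right) v n n' where "v \<in> carrier U" "n \<in> carrier N" "n' \<in> carrier N"
        "x = frag_of (v, n \<oplus>\<^bsub>N\<^esub> n') - frag_of (v, n) - frag_of (v, n')"
      | (balanced) v r n where "v \<in> carrier U" "r \<in> carrier R" "n \<in> carrier N"
        "x = frag_of (v \<otimes>\<^bsub>U\<^esub> h r, n) - frag_of (v, r \<odot>\<^bsub>N\<^esub> n)"
      using x unfolding tensor_rels_def by (elim UnE CollectE exE conjE) metis+
    then show ?thesis
    proof cases
      case (left v v' n)
      then show ?thesis using assms(1) H_add_left[of "u \<otimes>\<^bsub>U\<^esub> v" "u \<otimes>\<^bsub>U\<^esub> v'" n]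
        by (simp add: tensor_act_diff U.r_distr)
    next
      case (right v n n')
      then show ?thesis using assms(1) H_add_right[of "u \<otimes>\<^bsub>U\<^esub> v" n n']
        by (simp add: tensor_act_diff)
    next
      case (balanced v r n)
      then show ?thesis using assms(1) H_balanced[of "u \<otimes>\<^bsub>U\<^esub> v" r n] h_closed
        by (simp add: tensor_act_diff U.m_assoc)
    qed
  qed
  show ?thesis
    using assms(2) unfolding H_def
  proof (induction x rule: generate.induct)
    case (inv x)
    have "x \<in> carrier F" using inv tensor_rels_carrier by blast
    then have "inv\<^bsub>F\<^esub> x = 0 - x" by (simp add: F_def)
    then show ?case using H_diff[OF H_zero rel[OF inv]] tensor_act_diff[of u 0 x] by (simp add: H_def)
  qed (use rel H_zero H_add in \<open>auto simp: H_def tensor_act_add\<close>)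
qed

lemma rcos_eqI: "x \<in> carrier F \<Longrightarrow> y \<in> carrier F \<Longrightarrow> x - y \<in> H \<Longrightarrow> H #>\<^bsub>F\<^esub> x = H #>\<^bsub>F\<^esub> y"
  using H_subgroup unfolding F_def by (rule free_Abelian_group_rcos_eqI)

lemma tensor_act_hom: "u \<in> carrier U \<Longrightarrow> tensor_act u \<in> hom F F"
  using tensor_act_carrier by (intro homI) (auto simp: tensor_act_add)

lemma F_add: "x \<in> carrier F \<Longrightarrow> y \<in> carrier F \<Longrightarrow> x + y \<in> carrier F"
  using keys_add[of x y] by auto

lemma left_module_tensor_module: "left_module U (tensor_module U R h N)"
  unfolding tensor_module_eq_coset_module
proof (rule left_module_coset_module[OF U.ring_axioms F_comm_group H_subgroup tensor_act_hom])
  fix u v x assume uv: "u \<in> carrier U" "v \<in> carrier U" and x: "x \<in> carrier F"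
  have "tensor_act (u \<oplus>\<^bsub>U\<^esub> v) x - (tensor_act u x + tensor_act v x) \<in> H"
    using x
  proof (induction x rule: F_induct)
    case (one w n)
    then show ?case
      using H_add_left[of "u \<otimes>\<^bsub>U\<^esub> w" "v \<otimes>\<^bsub>U\<^esub> w" n] uv by (simp add: U.l_distr algebra_simps)
  next
    case (diff x y)
    from H_diff[OF diff.IH] show ?case by (simp add: tensor_act_diff algebra_simps)
  qed simp
  then show "H #>\<^bsub>F\<^esub> tensor_act (u \<oplus>\<^bsub>U\<^esub> v) x = H #>\<^bsub>F\<^esub> (tensor_act u x \<otimes>\<^bsub>F\<^esub> tensor_act v x)"
    unfolding F_simps using uv x by (intro rcos_eqI tensor_act_carrier F_add U.add.m_closed)
  have "tensor_act (u \<otimes>\<^bsub>U\<^esub> v) x = tensor_act u (tensor_act v x)"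
    using x by (induction x rule: F_induct) (use uv in \<open>simp_all add: U.m_assoc tensor_act_diff\<close>)
  then show "H #>\<^bsub>F\<^esub> tensor_act (u \<otimes>\<^bsub>U\<^esub> v) x = H #>\<^bsub>F\<^esub> tensor_act u (tensor_act v x)" by simp
next
  fix x assume "x \<in> carrier F"
  then have "tensor_act \<one>\<^bsub>U\<^esub> x = x"
    by (induction x rule: F_induct) (simp_all add: tensor_act_diff)
  then show "H #>\<^bsub>F\<^esub> tensor_act \<one>\<^bsub>U\<^esub> x = H #>\<^bsub>F\<^esub> x" by simp
qed (auto intro: tensor_act_H)

text \<open>The generator is t = 1 \<otimes> n0, because u \<otimes> (r n0) = (u h(r)) t. Moreover
  h(r) t = 1 \<otimes> (r n0) depends only on r n0; for the one-dimensional module this becomes the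
  Whittaker condition on t.\<close>

lemma tensor_module_cyclic:
  assumes n0: "n0 \<in> carrier N" and gen: "\<And>n. n \<in> carrier N \<Longrightarrow> \<exists>r\<in>carrier R. n = r \<odot>\<^bsub>N\<^esub> n0"
  defines "T \<equiv> tensor_module U R h N"
  shows "\<exists>t\<in>carrier T. (\<forall>m\<in>carrier T. \<exists>u\<in>carrier U. m = u \<odot>\<^bsub>T\<^esub> t) \<and>
    (\<forall>r\<in>carrier R. \<forall>s\<in>carrier R. r \<odot>\<^bsub>N\<^esub> n0 = s \<odot>\<^bsub>N\<^esub> n0 \<longrightarrow> h r \<odot>\<^bsub>T\<^esub> t = h s \<odot>\<^bsub>T\<^esub> t)"
proof -
  let ?t = "H #>\<^bsub>F\<^esub> frag_of (\<one>\<^bsub>U\<^esub>, n0)"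
  have smult: "u \<odot>\<^bsub>T\<^esub> ?t = H #>\<^bsub>F\<^esub> frag_of (u, n0)" if "u \<in> carrier U" for u
    unfolding T_def tensor_module_eq_coset_module using that n0 tensor_act_H
    by (subst coset_module_smult)
      (auto intro: comm_group.axioms(2) F_comm_group H_subgroup tensor_act_hom)
  have T: "carrier T = (\<lambda>x. H #>\<^bsub>F\<^esub> x) ` carrier F"
    by (auto simp: T_def tensor_module_eq_coset_module RCOSETS_def)
  have t: "?t \<in> carrier T" unfolding T using n0 by auto
  have rep: "\<exists>u\<in>carrier U. x - frag_of (u, n0) \<in> H" if "x \<in> carrier F" for x
    using that
  proof (induction x rule: F_induct)
    case zero
    \<comment> \<open>The additivity relation for 0 + 0 = 0 is minus the generator (0, n0), which
      shows 0 \<otimes> n0 = 0.\<close>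
    have "- (frag_of (\<zero>\<^bsub>U\<^esub> \<oplus>\<^bsub>U\<^esub> \<zero>\<^bsub>U\<^esub>, n0) - frag_of (\<zero>\<^bsub>U\<^esub>, n0) - frag_of (\<zero>\<^bsub>U\<^esub>, n0)) \<in> H"
      using n0 by (intro H_minus H_add_left) auto
    then have "frag_of (\<zero>\<^bsub>U\<^esub>, n0) \<in> H" by simp
    then show ?case using H_minus by (intro bexI[of _ "\<zero>\<^bsub>U\<^esub>"]) auto
  next
    case (one u n)
    then obtain r where r: "r \<in> carrier R" "n = r \<odot>\<^bsub>N\<^esub> n0" using gen by blast
    then have "frag_of (u, n) - frag_of (u \<otimes>\<^bsub>U\<^esub> h r, n0) \<in> H"
      using H_minus[OF H_balanced[OF one(1) r(1) n0]] by simp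
    then show ?case using one r h_closed by blast
  next
    case (diff x y)
    then obtain u v where uv: "u \<in> carrier U" "v \<in> carrier U"
      "x - frag_of (u, n0) \<in> H" "y - frag_of (v, n0) \<in> H" by blast
    \<comment> \<open>The relations speak of sums only; splitting u as (u - v) + v yields the rule
      for differences.\<close>
    have "u \<ominus>\<^bsub>U\<^esub> v \<oplus>\<^bsub>U\<^esub> v = u" using uv by algebra
    then have "frag_of (u, n0) - frag_of (u \<ominus>\<^bsub>U\<^esub> v, n0) - frag_of (v, n0) \<in> H"
      using H_add_left[of "u \<ominus>\<^bsub>U\<^esub> v" v n0] uv n0 by simp
    from H_add[OF H_diff[OF uv(3,4)] this] have "x - y - frag_of (u \<ominus>\<^bsub>U\<^esub> v, n0) \<in> H"
      by (simp add: algebra_simps)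
    then show ?case using uv by blast
  qed
  have cyc: "\<exists>u\<in>carrier U. m = u \<odot>\<^bsub>T\<^esub> ?t" if m: "m \<in> carrier T" for m
  proof -
    obtain x where x: "x \<in> carrier F" "m = H #>\<^bsub>F\<^esub> x" using m T by blast
    obtain u where u: "u \<in> carrier U" "x - frag_of (u, n0) \<in> H" using rep[OF x(1)] by blast
    then have "H #>\<^bsub>F\<^esub> x = H #>\<^bsub>F\<^esub> frag_of (u, n0)"
      using x n0 by (intro rcos_eqI) auto
    then have "m = u \<odot>\<^bsub>T\<^esub> ?t" using x u by (simp add: smult)
    then show ?thesis using u by blast
  qed
  have bal: "h r \<odot>\<^bsub>T\<^esub> ?t = H #>\<^bsub>F\<^esub> frag_of (\<one>\<^bsub>U\<^esub>, r \<odot>\<^bsub>N\<^esub> n0)" if "r \<in> carrier R" for r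
  proof -
    have "H #>\<^bsub>F\<^esub> frag_of (h r, n0) = H #>\<^bsub>F\<^esub> frag_of (\<one>\<^bsub>U\<^esub>, r \<odot>\<^bsub>N\<^esub> n0)"
      using that n0 H_balanced[of "\<one>\<^bsub>U\<^esub>" r n0] h_closed N_smult by (intro rcos_eqI) auto
    then show ?thesis using that by (simp add: smult h_closed)
  qed
  show ?thesis using t cyc bal by metis
qed

end

section \<open>The free algebra and the enveloping algebra\<close>

lemma mem_free_alg:
  "p \<in> carrier (free_alg S) \<longleftrightarrow> (\<forall>w\<in>Poly_Mapping.keys p. set (letters w) \<subseteq> S)"
  by (simp add: free_alg_def ring_of_type_algebra_def)

lemma free_alg_simps [simp]:
  "p \<otimes>\<^bsub>free_alg S\<^esub> q = p * q" "\<one>\<^bsub>free_alg S\<^esub> = 1"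
  "p \<oplus>\<^bsub>free_alg S\<^esub> q = p + q" "\<zero>\<^bsub>free_alg S\<^esub> = 0"
  by (simp_all add: free_alg_def ring_of_type_algebra_def)

lemma letters_simps [simp]: "letters 0 = []" "letters (v + w) = letters v @ letters w"
  by (simp_all add: zero_fword_def plus_fword_def)

lemma free_alg_closed [simp, intro]:
  shows "0 \<in> carrier (free_alg S)" "1 \<in> carrier (free_alg S)" "scalar c \<in> carrier (free_alg S)"
    and "p \<in> carrier (free_alg S) \<Longrightarrow> - p \<in> carrier (free_alg S)"
    and "p \<in> carrier (free_alg S) \<Longrightarrow> q \<in> carrier (free_alg S) \<Longrightarrow> p + q \<in> carrier (free_alg S)"
    and "p \<in> carrier (free_alg S) \<Longrightarrow> q \<in> carrier (free_alg S) \<Longrightarrow> p - q \<in> carrier (free_alg S)"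
    and "p \<in> carrier (free_alg S) \<Longrightarrow> q \<in> carrier (free_alg S) \<Longrightarrow> p * q \<in> carrier (free_alg S)"
proof -
  show "0 \<in> carrier (free_alg S)" by (simp add: mem_free_alg)
  show "scalar c \<in> carrier (free_alg S)" by (simp add: mem_free_alg scalar_def)
  show "1 \<in> carrier (free_alg S)" by (simp add: mem_free_alg flip: single_one)
next
  assume p: "p \<in> carrier (free_alg S)"
  then show "- p \<in> carrier (free_alg S)" by (auto simp: mem_free_alg in_keys_iff)
  assume q: "q \<in> carrier (free_alg S)"
  show "p + q \<in> carrier (free_alg S)"
    using p q keys_add[of p q] unfolding mem_free_alg by blast
  show "p - q \<in> carrier (free_alg S)"
    using p q keys_diff[of p q] unfolding mem_free_alg by blast
  show "p * q \<in> carrier (free_alg S)"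
    using p q keys_mult[of p q] unfolding mem_free_alg by fastforce
qed

lemma gen_carrier [simp]: "gen x \<in> carrier (free_alg S) \<longleftrightarrow> x \<in> S"
  by (simp add: mem_free_alg gen_def)

lemma mem_free_alg_UNIV [simp]: "p \<in> carrier (free_alg UNIV)"
  by (simp add: mem_free_alg)

lemma scalar_0 [simp]: "scalar 0 = 0"
  by (simp add: scalar_def)

lemma ring_free_alg: "ring (free_alg S)"
proof (rule ringI)
  show "abelian_group (free_alg S)"
  proof (rule abelian_groupI)
    fix p assume p: "p \<in> carrier (free_alg S)"
    then show "\<exists>q\<in>carrier (free_alg S). q \<oplus>\<^bsub>free_alg S\<^esub> p = \<zero>\<^bsub>free_alg S\<^esub>"
      by (intro bexI[of _ "- p"]) auto
  qed (auto simp: add_ac)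
  show "Group.monoid (free_alg S)"
    by (rule monoidI) (auto simp: mult.assoc)
qed (simp_all add: distrib_left distrib_right)

lemma free_alg_idealI:
  assumes "J \<subseteq> carrier (free_alg S)" "0 \<in> J"
    and add: "\<And>p q. p \<in> J \<Longrightarrow> q \<in> J \<Longrightarrow> p + q \<in> J"
    and l: "\<And>p q. p \<in> J \<Longrightarrow> q \<in> carrier (free_alg S) \<Longrightarrow> q * p \<in> J"
    and r: "\<And>p q. p \<in> J \<Longrightarrow> q \<in> carrier (free_alg S) \<Longrightarrow> p * q \<in> J"
  shows "ideal J (free_alg S)"
proof (rule idealI[OF ring_free_alg])
  interpret ring "free_alg S" by (rule ring_free_alg)
  show "subgroup J (add_monoid (free_alg S))"
  proof
    fix p assume p: "p \<in> J"
    then have "p \<in> carrier (free_alg S)" using assms(1) by blast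
    then have "\<ominus>\<^bsub>free_alg S\<^esub> p = - p" by (intro minus_equality) auto
    then show "inv\<^bsub>add_monoid (free_alg S)\<^esub> p \<in> J"
      using l[OF p, of "- 1"] by (simp add: a_inv_def)
  qed (use assms in auto)
qed (use l r in auto)

lemma ideal_free_algD:
  assumes "ideal J (free_alg S)"
  shows "J \<subseteq> carrier (free_alg S)" "0 \<in> J"
    "\<And>p q. p \<in> J \<Longrightarrow> q \<in> J \<Longrightarrow> p + q \<in> J" "\<And>p q. p \<in> J \<Longrightarrow> q \<in> J \<Longrightarrow> p - q \<in> J"
    "\<And>p q. p \<in> J \<Longrightarrow> q \<in> carrier (free_alg S) \<Longrightarrow> q * p \<in> J"
    "\<And>p q. p \<in> J \<Longrightarrow> q \<in> carrier (free_alg S) \<Longrightarrow> p * q \<in> J"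
proof -
  interpret ideal J "free_alg S" by fact
  show "J \<subseteq> carrier (free_alg S)" by (rule a_subset)
  show "0 \<in> J" using additive_subgroup.zero_closed[OF additive_subgroup_axioms] by simp
  show add: "p + q \<in> J" if "p \<in> J" "q \<in> J" for p q using additive_subgroup.a_closed[OF additive_subgroup_axioms that] by simp
  show l: "q * p \<in> J" if "p \<in> J" "q \<in> carrier (free_alg S)" for p q
    using I_l_closed[OF that] by simp
  show "p * q \<in> J" if "p \<in> J" "q \<in> carrier (free_alg S)" for p q
    using I_r_closed[OF that] by simp
  show "p - q \<in> J" if "p \<in> J" "q \<in> J" for p q
    using add[OF that(1) l[OF that(2), of "- 1"]] by simp
qed

text \<open>The ideals used below are generated by relations whose letters lie in \<open>S\<close>; otherwise
  \<^const>\<open>genideal\<close> would be an empty intersection.\<close>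

lemma free_alg_genideal_subset:
  assumes "ideal J (free_alg T)" "S \<subseteq> T" "B \<subseteq> carrier (free_alg S)" "B \<subseteq> J"
  shows "Idl\<^bsub>free_alg S\<^esub> B \<subseteq> J" "ideal (Idl\<^bsub>free_alg S\<^esub> B) (free_alg S)"
proof -
  interpret ring "free_alg S" by (rule ring_free_alg)
  have ST: "carrier (free_alg S) \<subseteq> carrier (free_alg T)"
    using assms(2) by (fastforce simp: mem_free_alg)
  note J = ideal_free_algD[OF assms(1)]
  \<comment> \<open>The trace of \<open>J\<close> on the smaller free algebra is an ideal there, so
    minimality of the generated ideal applies to it.\<close>
  have "ideal (J \<inter> carrier (free_alg S)) (free_alg S)"
    by (rule free_alg_idealI) (use J ST in auto)
  then have "Idl\<^bsub>free_alg S\<^esub> B \<subseteq> J \<inter> carrier (free_alg S)"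
    by (rule genideal_minimal) (use assms in blast)
  then show "Idl\<^bsub>free_alg S\<^esub> B \<subseteq> J" by blast
  show "ideal (Idl\<^bsub>free_alg S\<^esub> B) (free_alg S)" by (rule genideal_ideal) fact
qed

definition bracket_rels :: "('g \<Rightarrow> 'g \<Rightarrow> 'g) \<Rightarrow> 'g set \<Rightarrow> 'g free_elem set" where
  "bracket_rels bracket S = {gen x * gen y - gen y * gen x - gen (bracket x y) | x y. x \<in> S \<and> y \<in> S}"

section \<open>The enveloping algebra as the free algebra modulo \<open>J\<close>\<close>

context lie_algebra
begin

abbreviation "J \<equiv> env_ideal scale bracket UNIV"

lemma env_ideal_UNIV: "ideal J (free_alg UNIV)"
  unfolding env_ideal_def by (rule ring.genideal_ideal[OF ring_free_alg]) auto

lemmas J = ideal_free_algD(2-4)[OF env_ideal_UNIV]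
  ideal_free_algD(5,6)[OF env_ideal_UNIV _ mem_free_alg_UNIV]

lemma rels_J: "linear_rels scale UNIV \<union> bracket_rels bracket UNIV \<subseteq> J"
  unfolding env_ideal_def bracket_rels_def
  by (rule ring.genideal_self[OF ring_free_alg]) auto

lemma J_gen_add: "gen (x + y) - gen x - gen y \<in> J"
  and J_gen_scale: "gen (scale c x) - scalar c * gen x \<in> J"
  and J_gen_bracket: "gen x * gen y - gen y * gen x - gen (bracket x y) \<in> J"
  by (rule subsetD[OF rels_J]; force simp: linear_rels_def bracket_rels_def)+

text \<open>The one-letter word on 0 is not the zero of the free algebra; it vanishes only modulo
  the relation for scaling by 0.\<close>

lemma J_gen_zero: "gen 0 \<in> J"
  using J_gen_scale[of 0 0] by simp

lemma linear_rels_carrier: "subspace S \<Longrightarrow> linear_rels scale S \<subseteq> carrier (free_alg S)"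
  unfolding linear_rels_def
  by (auto simp: subspace_add subspace_scale)

lemma env_ideal_rels_carrier:
  assumes "subspace S" "\<And>x y. x \<in> S \<Longrightarrow> y \<in> S \<Longrightarrow> bracket x y \<in> S"
  shows "linear_rels scale S \<union> bracket_rels bracket S \<subseteq> carrier (free_alg S)"
proof (rule Un_least[OF linear_rels_carrier[OF assms(1)]])
  show "bracket_rels bracket S \<subseteq> carrier (free_alg S)"
    using assms(2) by (auto simp: bracket_rels_def)
qed

text \<open>The relations of a subalgebra are among those of the whole Lie algebra. This is what
  makes the map between the enveloping algebras well defined.\<close>

lemma env_ideal_subset:
  assumes "subspace S" "\<And>x y. x \<in> S \<Longrightarrow> y \<in> S \<Longrightarrow> bracket x y \<in> S"
  shows "env_ideal scale bracket S \<subseteq> J" "ideal (env_ideal scale bracket S) (free_alg S)"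
proof -
  have "linear_rels scale S \<union> bracket_rels bracket S \<subseteq> J"
    using J_gen_add J_gen_scale J_gen_bracket by (auto simp: linear_rels_def bracket_rels_def)
  note sub = free_alg_genideal_subset[OF env_ideal_UNIV subset_UNIV
      env_ideal_rels_carrier[OF assms] this]
  show "env_ideal scale bracket S \<subseteq> J" "ideal (env_ideal scale bracket S) (free_alg S)"
    using sub unfolding env_ideal_def[of _ _ S] bracket_rels_def by auto
qed

lemma ring_env_alg: "ring (env_alg scale bracket UNIV)"
  unfolding env_alg_def by (rule ideal.quotient_is_ring[OF env_ideal_UNIV])

lemma env_class_carrier [simp]: "env_class scale bracket p \<in> carrier (env_alg scale bracket UNIV)"
  and env_class_add: "env_class scale bracket (p + q) =
    env_class scale bracket p \<oplus>\<^bsub>env_alg scale bracket UNIV\<^esub> env_class scale bracket q"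
  and env_class_mult: "env_class scale bracket (p * q) =
    env_class scale bracket p \<otimes>\<^bsub>env_alg scale bracket UNIV\<^esub> env_class scale bracket q"
proof -
  have h: "env_class scale bracket \<in> ring_hom (free_alg UNIV) (env_alg scale bracket UNIV)"
    unfolding env_alg_def using ideal.rcos_ring_hom[OF env_ideal_UNIV]
    by (simp add: env_class_def[abs_def])
  show "env_class scale bracket p \<in> carrier (env_alg scale bracket UNIV)"
    by (rule ring_hom_closed[OF h]) simp
  show "env_class scale bracket (p + q) =
      env_class scale bracket p \<oplus>\<^bsub>env_alg scale bracket UNIV\<^esub> env_class scale bracket q"
    using ring_hom_add[OF h, of p q] by simp
  show "env_class scale bracket (p * q) =
      env_class scale bracket p \<otimes>\<^bsub>env_alg scale bracket UNIV\<^esub> env_class scale bracket q"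
    using ring_hom_mult[OF h, of p q] by simp
qed

lemma env_alg_carrier:
  assumes "u \<in> carrier (env_alg scale bracket S)"
  obtains p where "p \<in> carrier (free_alg S)"
    "u = env_ideal scale bracket S +>\<^bsub>free_alg S\<^esub> p"
  using assms unfolding env_alg_def FactRing_def A_RCOSETS_def' by auto

lemma env_class_surj:
  assumes "u \<in> carrier (env_alg scale bracket UNIV)"
  obtains p where "u = env_class scale bracket p"
  by (rule env_alg_carrier[OF assms]) (use that in \<open>simp add: env_class_def\<close>)

lemma env_class_eqI:
  assumes "p - q \<in> J"
  shows "env_class scale bracket p = env_class scale bracket q"
proof -
  have "env_class scale bracket p = (\<lambda>x. x + p) ` J" for p
    by (auto simp: env_class_def a_r_coset_def')
  moreover have "(\<lambda>x. x + p) ` J = (\<lambda>x. x + q) ` J"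
  proof (intro equalityI image_subsetI)
    fix x assume x: "x \<in> J"
    have "x + p = (x + (p - q)) + q" "x + q = (x - (p - q)) + p" by simp_all
    then show "x + p \<in> (\<lambda>x. x + q) ` J" "x + q \<in> (\<lambda>x. x + p) ` J"
      using J(2)[OF x assms] J(3)[OF x assms] by blast+
  qed
  ultimately show ?thesis by simp
qed

lemma env_class_zero: "p \<in> J \<Longrightarrow> env_class scale bracket p = \<zero>\<^bsub>env_alg scale bracket UNIV\<^esub>"
proof -
  assume "p \<in> J"
  then have "env_class scale bracket p = J"
    unfolding env_class_def
    by (intro abelian_group.a_coset_join2 ring.is_abelian_group[OF ring_free_alg]
        additive_subgroup.a_subgroup ideal.axioms(1)[OF env_ideal_UNIV]) auto
  then show ?thesis by (simp add: env_alg_def FactRing_def)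
qed

text \<open>With \<open>K\<close> inside \<open>J\<close>, all representatives of a coset of
  \<open>K\<close> have the same class, so the union defining \<open>env_incl\<close> is that single
  class. It is applied both to U(n) and to the symmetric algebra.\<close>

lemma env_incl_coset:
  assumes "K \<subseteq> J" "0 \<in> K"
  shows "env_incl scale bracket (K +>\<^bsub>free_alg S\<^esub> p) = env_class scale bracket p"
proof -
  have "env_class scale bracket (k + p) = env_class scale bracket p" if "k \<in> K" for k
    by (rule env_class_eqI) (use that assms in auto)
  then show ?thesis using assms(2) by (auto simp: env_incl_def a_r_coset_def')
qed

text \<open>Commutation with \<open>p\<close> is a derivation: [p, x q] = [p,x] q + x [p,q]. Hence
  the letters determine the words, and scalars are central.\<close>

lemma commutator_in_J:
  assumes "\<And>x. x \<in> S \<Longrightarrow> p * gen x - gen x * p \<in> J" "q \<in> carrier (free_alg S)"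
  shows "p * q - q * p \<in> J"
proof -
  have "Poly_Mapping.keys q \<subseteq> {w. set (letters w) \<subseteq> S}" using assms(2) by (auto simp: mem_free_alg)
  then show ?thesis
  proof (induction q rule: poly_mapping_single_induct)
    case zero
    then show ?case using J(1) by simp
  next
    case (single w c)
    have "p * Poly_Mapping.single (FWord xs) 1 - Poly_Mapping.single (FWord xs) 1 * p \<in> J"
      if "set xs \<subseteq> S" for xs
      using that
    proof (induction xs)
      case Nil
      have "Poly_Mapping.single (FWord []) 1 = (1 :: 'g free_elem)"
        by (metis single_one zero_fword_def)
      then show ?case using J(1) by simp
    next
      case (Cons x xs)
      define q where "q = (Poly_Mapping.single (FWord xs) 1 :: 'g free_elem)"
      have "(p * gen x - gen x * p) * q + gen x * (p * q - q * p) \<in> J"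
        using Cons assms(1) J(2)[OF J(5) J(4)] by (simp add: q_def)
      moreover have "Poly_Mapping.single (FWord (x # xs)) 1 = gen x * q"
        by (simp add: gen_def q_def mult_single plus_fword_def)
      ultimately show ?case by (simp add: algebra_simps)
    qed
    then have "p * Poly_Mapping.single w 1 - Poly_Mapping.single w 1 * p \<in> J"
      using single by (cases w) auto
    then have "scalar c * (p * Poly_Mapping.single w 1 - Poly_Mapping.single w 1 * p) \<in> J"
      by (rule J)
    moreover have "Poly_Mapping.single w c = scalar c * Poly_Mapping.single w 1"
      by (simp add: scalar_def mult_single)
    moreover have "scalar c * (p * r) = p * (scalar c * r)" for r
      by (metis mult.assoc scalar_mult_commute)
    ultimately show ?case by (simp add: right_diff_distrib mult.assoc)
  next
    case (add q r)
    from J(2)[OF this] show ?case by (simp add: algebra_simps)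
  qed
qed

text \<open>\<open>commutator_in_J\<close> is applied twice: first a central letter is compared with
  all letters, then an arbitrary \<open>q\<close> with the central letters occurring in
  \<open>p\<close>.\<close>

lemma central_commutator_in_J:
  assumes "p \<in> carrier (free_alg C)" "C \<subseteq> lie_center bracket"
  shows "p * q - q * p \<in> J"
proof -
  have "q * gen z - gen z * q \<in> J" if "z \<in> C" for z
  proof -
    have "gen z * gen x - gen x * gen z \<in> J" for x
    proof -
      have "bracket z x = 0" using that assms(2) by (auto simp: lie_center_def)
      then show ?thesis using J(2)[OF J_gen_bracket[of z x] J_gen_zero] by simp
    qed
    then have "gen z * q - q * gen z \<in> J"
      by (rule commutator_in_J[of UNIV]) auto
    from J(3)[OF J(1) this] show ?thesis by simp
  qed
  then have "q * p - p * q \<in> J" using assms(1) by (rule commutator_in_J[of C]) auto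
  from J(3)[OF J(1) this] show ?thesis by simp
qed

text \<open>Letters of \<open>C\<close> commute modulo \<open>J\<close> by centrality, so the
  defining ideal of the symmetric algebra lies in \<open>J\<close> and \<open>env_incl_coset\<close>
  applies.\<close>

lemma sym_alg_incl:
  assumes "subspace C" "C \<subseteq> lie_center bracket" "a \<in> carrier (sym_alg scale C)"
  obtains p where "p \<in> carrier (free_alg C)" "env_incl scale bracket a = env_class scale bracket p"
proof -
  define K where "K = Idl\<^bsub>free_alg C\<^esub> (linear_rels scale C \<union>
     {gen x * gen y - gen y * gen x | x y. x \<in> C \<and> y \<in> C})"
  have rels: "linear_rels scale C \<union> {gen x * gen y - gen y * gen x | x y. x \<in> C \<and> y \<in> C} \<subseteq> J"
    using J_gen_add J_gen_scale central_commutator_in_J[OF _ assms(2), of "gen _"]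
    by (auto simp: linear_rels_def)
  have car: "linear_rels scale C \<union> {gen x * gen y - gen y * gen x | x y. x \<in> C \<and> y \<in> C}
      \<subseteq> carrier (free_alg C)"
    using linear_rels_carrier[OF assms(1)]
    by auto
  note K = free_alg_genideal_subset[OF env_ideal_UNIV subset_UNIV car rels, folded K_def]
  obtain p where "p \<in> carrier (free_alg C)" "a = K +>\<^bsub>free_alg C\<^esub> p"
    using assms(3) unfolding sym_alg_def K_def[symmetric] FactRing_def A_RCOSETS_def' by auto
  then show ?thesis using that env_incl_coset[OF K(1)] ideal_free_algD(2)[OF K(2)] by metis
qed

end

section \<open>Evaluation of characters\<close>

lemma free_eval_eq:
  assumes "finite A" "Poly_Mapping.keys p \<subseteq> A"
  shows "free_eval \<phi> p = (\<Sum>w\<in>A. Poly_Mapping.lookup p w * prod_list (map \<phi> (letters w)))"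
  unfolding free_eval_def using assms by (intro sum.mono_neutral_left) (auto simp: in_keys_iff)

lemma free_eval_add: "free_eval \<phi> (p + q) = free_eval \<phi> p + free_eval \<phi> q"
proof -
  let ?A = "Poly_Mapping.keys p \<union> Poly_Mapping.keys q"
  have "free_eval \<phi> r = (\<Sum>w\<in>?A. Poly_Mapping.lookup r w * prod_list (map \<phi> (letters w)))"
    if "Poly_Mapping.keys r \<subseteq> ?A" for r
    using that by (intro free_eval_eq) auto
  then show ?thesis using keys_add[of p q]
    by (simp add: lookup_add distrib_right sum.distrib)
qed

lemma free_eval_single [simp]:
  "free_eval \<phi> (Poly_Mapping.single w c) = c * prod_list (map \<phi> (letters w))"
  by (subst free_eval_eq[of "{w}"]) auto

lemma free_eval_zero [simp]: "free_eval \<phi> 0 = 0"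
  by (simp add: free_eval_def)

lemma free_eval_diff: "free_eval \<phi> (p - q) = free_eval \<phi> p - free_eval \<phi> q"
  using free_eval_add[of \<phi> "p - q" q] by simp

lemma free_eval_mult: "free_eval \<phi> (p * q) = free_eval \<phi> p * free_eval \<phi> q"
  using subset_UNIV
proof (induction p rule: poly_mapping_single_induct)
  case (single v a)
  show ?case
    using subset_UNIV
    by (induction q rule: poly_mapping_single_induct)
      (simp_all add: mult_single distrib_left free_eval_add)
qed (simp_all add: distrib_right free_eval_add)

lemma free_eval_gen [simp]: "free_eval \<phi> (gen x) = \<phi> x"
  and free_eval_scalar [simp]: "free_eval \<phi> (scalar c) = c"
  by (simp_all add: gen_def scalar_def)

text \<open>The kernel of evaluation is an ideal. It contains the bracket relations because complex
  numbers commute and \<phi> kills brackets, so evaluation is constant on each class.\<close>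

lemma (in lie_algebra) env_eval_coset:
  assumes "subspace S" "\<And>x y. x \<in> S \<Longrightarrow> y \<in> S \<Longrightarrow> bracket x y \<in> S"
    "lie_character scale bracket S \<phi>"
  shows "env_eval \<phi> (env_ideal scale bracket S +>\<^bsub>free_alg S\<^esub> p) = free_eval \<phi> p"
proof -
  let ?K = "env_ideal scale bracket S"
  let ?E = "{p \<in> carrier (free_alg S). free_eval \<phi> p = 0}"
  have "ideal ?E (free_alg S)"
    by (rule free_alg_idealI)
      (auto simp: free_eval_add free_eval_mult)
  moreover have "linear_rels scale S \<union> bracket_rels bracket S \<subseteq> ?E"
    using assms(2,3) unfolding lie_character_def linear_rels_def bracket_rels_def
    by (auto simp: free_eval_diff free_eval_mult subspace_add[OF assms(1)]
        subspace_scale[OF assms(1)])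
  ultimately have "?K \<subseteq> ?E"
    unfolding env_ideal_def bracket_rels_def[symmetric]
    by (rule ring.genideal_minimal[OF ring_free_alg])
  moreover have "0 \<in> ?K" using ideal_free_algD(2) env_ideal_subset(2)[OF assms(1,2)] by blast
  ultimately have "free_eval \<phi> ` (?K +>\<^bsub>free_alg S\<^esub> p) = {free_eval \<phi> p}"
    by (force simp: a_r_coset_def' free_eval_add)
  then show ?thesis by (simp add: env_eval_def)
qed

section \<open>Whittaker vectors\<close>

lemma (in lie_algebra) bracket_simps:
  "bracket x (y + z) = bracket x y + bracket x z" "bracket x (scale c y) = scale c (bracket x y)"
  "bracket (x + y) z = bracket x z + bracket y z" "bracket (scale c x) z = scale c (bracket x z)"
  "bracket 0 z = 0" "bracket x 0 = 0"
proof -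
  interpret r: Vector_Spaces.linear scale scale "\<lambda>y. bracket x y" for x
    by (rule bracket_linear_right)
  interpret l: Vector_Spaces.linear scale scale "\<lambda>x. bracket x y" for y
    by (rule bracket_linear_left)
  show "bracket x (y + z) = bracket x y + bracket x z"
    "bracket x (scale c y) = scale c (bracket x y)"
    "bracket (x + y) z = bracket x z + bracket y z"
    "bracket (scale c x) z = scale c (bracket x z)"
    "bracket 0 z = 0" "bracket x 0 = 0"
    by (rule r.add r.scale l.add l.scale l.zero r.zero)+
qed

lemma (in lie_algebra) subspace_lie_center: "subspace (lie_center bracket)"
  by (rule subspaceI) (simp_all add: lie_center_def bracket_simps)

text \<open>Additivity of \<pi> keeps sums of positive degrees positive; bilinearity extends this to
  the span, one argument at a time.\<close>

lemma (in graded_lie_algebra) n_plus_bracket: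
  assumes pi_add: "\<And>\<alpha> \<beta>. \<pi> (\<alpha> + \<beta>) = \<pi> \<alpha> + \<pi> \<beta>"
    and "x \<in> n_plus scale gr \<pi>" "y \<in> n_plus scale gr \<pi>"
  shows "bracket x y \<in> n_plus scale gr \<pi>"
proof -
  let ?B = "\<Union>\<alpha>\<in>{\<alpha>. \<pi> \<alpha> > 0}. gr \<alpha>"
  have hom: "bracket a b \<in> span ?B" if a: "a \<in> ?B" and b: "b \<in> ?B" for a b
  proof -
    obtain \<alpha> \<beta> where "a \<in> gr \<alpha>" "b \<in> gr \<beta>" "\<pi> \<alpha> > 0" "\<pi> \<beta> > 0" using a b by blast
    then have "bracket a b \<in> gr (\<alpha> + \<beta>)" "\<pi> (\<alpha> + \<beta>) > 0"
      using gr_bracket by (auto simp: pi_add)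
    then show ?thesis by (intro span_base) blast
  qed
  have right: "bracket a y \<in> span ?B" if a: "a \<in> ?B" and y: "y \<in> span ?B" for a y
    using y
    by (induction rule: span_induct_alt)
      (auto simp: bracket_simps intro: span_zero span_add span_scale hom[OF a]
        simp del: UN_iff)
  show ?thesis
    using assms(2,3) unfolding n_plus_def
    by (induction rule: span_induct_alt)
      (auto simp: bracket_simps intro: span_zero span_add span_scale right simp del: UN_iff)
qed

theorem lemma3p2p2:
  fixes scale :: "complex \<Rightarrow> 'g::ab_group_add \<Rightarrow> 'g"
    and bracket :: "'g \<Rightarrow> 'g \<Rightarrow> 'g"
    and gr :: "'q::linordered_ab_group_add \<Rightarrow> 'g set"
    and \<pi> :: "'q \<Rightarrow> int"
    and \<phi> :: "'g \<Rightarrow> complex"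
    and I :: "'g free_elem set set"
    and W :: "'g whittaker_elem set set"
  defines "n \<equiv> n_plus scale gr \<pi>"
  defines "M \<equiv> whittaker_module scale bracket n \<phi>"
  defines "V \<equiv> lie_module_of scale bracket (quot_module M (ideal_times scale bracket I M))"
  assumes "free_abelian TYPE('q)"
    and "\<And>\<alpha> \<beta>. \<pi> (\<alpha> + \<beta>) = \<pi> \<alpha> + \<pi> \<beta>"
    and "mono \<pi>"
    and "graded_lie_algebra scale bracket gr"
    and "Q_good scale bracket gr \<pi>"
    and "lie_character scale bracket n \<phi>"
    and "ideal I (sym_alg scale (center_minus scale bracket gr \<pi>))"
    and "lie_submodule W V"
    and "W \<noteq> {\<zero>\<^bsub>V\<^esub>}"
  shows "\<exists>w\<in>W. w \<noteq> \<zero>\<^bsub>V\<^esub> \<and> whittaker_vector n \<phi> V w"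
proof -
  note pi_add = assms(5) and char = assms(9) and I = assms(10) and W = assms(11,12)
  interpret graded_lie_algebra scale bracket gr by fact
  define U where "U = env_alg scale bracket UNIV"
  define R where "R = env_alg scale bracket n"
  let ?cls = "env_class scale bracket" and ?h = "env_incl scale bracket"
  let ?K = "env_ideal scale bracket n" and ?N = "ideal_times scale bracket I M"
  have n_sub: "subspace n" unfolding n_def n_plus_def by (rule subspace_span)
  have n_br: "bracket x y \<in> n" if "x \<in> n" "y \<in> n" for x y
    using n_plus_bracket[where \<pi> = \<pi>, OF pi_add] that unfolding n_def by blast
  note K = env_ideal_subset[OF n_sub n_br]
  have h: "?h (?K +>\<^bsub>free_alg n\<^esub> p) = ?cls p" for p
    using K ideal_free_algD(2) by (intro env_incl_coset) auto
  have ev: "env_eval \<phi> (?K +>\<^bsub>free_alg n\<^esub> p) = free_eval \<phi> p" for p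
    by (rule env_eval_coset[OF n_sub n_br char])
  have R: "?K +>\<^bsub>free_alg n\<^esub> p \<in> carrier R" if "p \<in> carrier (free_alg n)" for p
    using that by (auto simp: R_def env_alg_def FactRing_def A_RCOSETS_def')
  note cls_closed = env_class_carrier[folded U_def]
  note cls_add = env_class_add[folded U_def] and cls_mult = env_class_mult[folded U_def]
    and cls_zero = env_class_zero[folded U_def]

  interpret T: tensor_data U R ?h "char_module \<phi>"
  proof (intro tensor_data.intro tensor_data_axioms.intro)
    show "ring U" unfolding U_def by (rule ring_env_alg)
    show "?h r \<in> carrier U" if "r \<in> carrier R" for r
      using env_alg_carrier[OF that[unfolded R_def]] h cls_closed by metis
  qed (simp_all add: char_module_def mk_module_def)
  have M_eq: "M = tensor_module U R ?h (char_module \<phi>)"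
    by (simp add: M_def whittaker_module_def U_def R_def)
  interpret M: left_module U M unfolding M_eq by (rule T.left_module_tensor_module)
  have char_carrier: "carrier (char_module \<phi>) = UNIV"
    by (simp add: char_module_def mk_module_def)
  have char_smult: "(?K +>\<^bsub>free_alg n\<^esub> p) \<odot>\<^bsub>char_module \<phi>\<^esub> 1 = free_eval \<phi> p" for p
    by (simp add: char_module_def mk_module_def ev)
  \<comment> \<open>The class of \<open>scalar a\<close> sends 1 to a, so 1 generates the
    one-dimensional module and \<open>M\<close> is cyclic.\<close>
  have "\<exists>r\<in>carrier R. a = r \<odot>\<^bsub>char_module \<phi>\<^esub> 1" for a
    using R[of "scalar a"] char_smult[of "scalar a"] by (intro bexI) auto
  with T.tensor_module_cyclic[of 1, folded M_eq]
  obtain t where t: "t \<in> carrier M"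
    and cyclic: "\<forall>m\<in>carrier M. \<exists>u\<in>carrier U. m = u \<odot>\<^bsub>M\<^esub> t"
    and bal: "\<forall>r\<in>carrier R. \<forall>s\<in>carrier R. r \<odot>\<^bsub>char_module \<phi>\<^esub> 1 = s \<odot>\<^bsub>char_module \<phi>\<^esub> 1
      \<longrightarrow> ?h r \<odot>\<^bsub>M\<^esub> t = ?h s \<odot>\<^bsub>M\<^esub> t"
    by (metis (no_types, lifting) char_carrier UNIV_I)
  \<comment> \<open>For x in \<open>n\<close>, both \<open>gen x\<close> and
    \<open>scalar (\<phi> x)\<close> evaluate to \<phi> x, so balancing makes them agree on
    t.\<close>
  have t_char: "?cls (gen x) \<odot>\<^bsub>M\<^esub> t = ?cls (scalar (\<phi> x)) \<odot>\<^bsub>M\<^esub> t" if "x \<in> n" for x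
    using bal[rule_format, OF R R, of "gen x" "scalar (\<phi> x)"] that by (simp add: h char_smult)

  have C: "subspace (center_minus scale bracket gr \<pi>)"
    "center_minus scale bracket gr \<pi> \<subseteq> lie_center bracket"
    unfolding center_minus_def b_minus_def
    by (auto intro: subspace_inter subspace_lie_center subspace_span)
  \<comment> \<open>Elements of \<open>I\<close> act through polynomials in central letters, which
    commute with everything modulo \<open>J\<close>.\<close>
  have I_rep: "\<exists>p. ?h a = ?cls p \<and> (\<forall>q. p * q - q * p \<in> J)" if "a \<in> I" for a
  proof -
    have "a \<in> carrier (sym_alg scale (center_minus scale bracket gr \<pi>))"
      using additive_subgroup.a_subset[OF ideal.axioms(1)[OF I]] that by blast
    then show ?thesis using sym_alg_incl[OF C] central_commutator_in_J[OF _ C(2)] by metis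
  qed
  let ?G = "{?h a \<odot>\<^bsub>M\<^esub> m | a m. a \<in> I \<and> m \<in> carrier M}"
  have G: "?G \<subseteq> carrier M" using I_rep cls_closed M.smult_closed by fastforce
  \<comment> \<open>By centrality u (a m) = a (u m), so the generators of \<open>IM\<close> are
    stable under the enveloping algebra.\<close>
  have G_smult: "u \<odot>\<^bsub>M\<^esub> x \<in> ?G" if u: "u \<in> carrier U" and x: "x \<in> ?G" for u x
  proof -
    obtain q where q: "u = ?cls q" using env_class_surj u unfolding U_def by metis
    obtain a m where am: "x = ?h a \<odot>\<^bsub>M\<^esub> m" "a \<in> I" "m \<in> carrier M" using x by blast
    obtain p where p: "?h a = ?cls p" "p * q - q * p \<in> J" using I_rep[OF am(2)] by blast
    have "u \<odot>\<^bsub>M\<^esub> x = ?cls (q * p) \<odot>\<^bsub>M\<^esub> m"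
      using am p q cls_closed by (simp add: cls_mult M.smult_assoc)
    also have "?cls (q * p) = ?cls (p * q)" using env_class_eqI[OF p(2)] by simp
    also have "?cls (p * q) \<odot>\<^bsub>M\<^esub> m = ?h a \<odot>\<^bsub>M\<^esub> (u \<odot>\<^bsub>M\<^esub> m)"
      using am p q cls_closed by (simp add: cls_mult M.smult_assoc)
    finally show ?thesis using am u by blast
  qed
  have N: "subgroup ?N (add_monoid M)"
    unfolding ideal_times_def using M.M.add.generate_is_subgroup[of ?G] G by simp
  have N_smult: "u \<odot>\<^bsub>M\<^esub> x \<in> ?N" if u: "u \<in> carrier U" and x: "x \<in> ?N" for u x
    using M.generate_smult_closed[OF G u G_smult[OF u]] x unfolding ideal_times_def by blast

  define Q where "Q = quot_module M ?N"
  interpret Q: left_module U Q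
    unfolding Q_def by (rule M.left_module_quot_module[OF N N_smult])
  define tq where "tq = ?N +>\<^bsub>M\<^esub> t"
  have Q_smult: "u \<odot>\<^bsub>Q\<^esub> (?N +>\<^bsub>M\<^esub> x) = ?N +>\<^bsub>M\<^esub> (u \<odot>\<^bsub>M\<^esub> x)"
    if "u \<in> carrier U" "x \<in> carrier M" for u x
    unfolding Q_def using that by (intro M.quot_module_smult[OF N N_smult])
  have Q_carrier: "carrier Q = (\<lambda>x. ?N +>\<^bsub>M\<^esub> x) ` carrier M"
    by (auto simp: Q_def quot_module_def mk_module_def A_RCOSETS_def')
  have tq: "tq \<in> carrier Q" using t by (simp add: Q_carrier tq_def)
  \<comment> \<open>Evaluation at the cyclic vector maps the free algebra onto the quotient module;
    its kernel is the left ideal \<open>L\<close> of the filtration argument.\<close>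
  define ev' where "ev' p = ?cls p \<odot>\<^bsub>Q\<^esub> tq" for p
  have ev_closed: "ev' p \<in> carrier Q" for p using tq cls_closed by (simp add: ev'_def)
  have ev_add: "ev' (p + q) = ev' p \<oplus>\<^bsub>Q\<^esub> ev' q" for p q
    using tq cls_closed by (simp add: ev'_def cls_add Q.smult_l_distr)
  have ev_mult: "ev' (p * q) = ?cls p \<odot>\<^bsub>Q\<^esub> ev' q" for p q
    using tq cls_closed by (simp add: ev'_def cls_mult Q.smult_assoc)
  have ev_surj: "\<exists>p. w = ev' p" if w: "w \<in> carrier Q" for w
  proof -
    obtain m where m: "m \<in> carrier M" "w = ?N +>\<^bsub>M\<^esub> m" using w Q_carrier by auto
    then obtain u where u: "u \<in> carrier U" "m = u \<odot>\<^bsub>M\<^esub> t" using cyclic by blast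
    obtain p where p: "u = ?cls p" by (rule env_class_surj[OF u(1)[unfolded U_def]])
    have "w = ev' p" unfolding ev'_def tq_def using Q_smult[OF u(1) t] m u p by simp
    then show ?thesis ..
  qed
  have ev_diff: "ev' (p - q) = \<zero>\<^bsub>Q\<^esub> \<longleftrightarrow> ev' p = ev' q" for p q
    using ev_add[of "p - q" q] Q.M.add.r_cancel_one[OF ev_closed[of q] ev_closed[of "p - q"]]
    by auto

  interpret L: whittaker_left_ideal scale bracket gr \<pi> \<phi> "{p. ev' p = \<zero>\<^bsub>Q\<^esub>}"
  proof (unfold_locales, goal_cases)
    \<comment> \<open>This goal is \<open>L_character\<close>: the identity x t = \<phi>(x) t in
      \<open>M\<close> descends to the quotient.\<close>
    case (8 x)
    then have "?cls (gen x) \<odot>\<^bsub>M\<^esub> t = ?cls (scalar (\<phi> x)) \<odot>\<^bsub>M\<^esub> t"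
      using t_char unfolding n_def by blast
    then have "ev' (gen x) = ev' (scalar (\<phi> x))"
      using t by (simp add: ev'_def tq_def Q_smult cls_closed)
    then show ?case by (simp add: ev_diff)
  qed (use pi_add char J_gen_add J_gen_scale J_gen_bracket in
    \<open>simp_all add: n_def ev_add ev_mult cls_zero cls_closed ev_closed\<close>)

  have V: "carrier V = carrier Q" "\<zero>\<^bsub>V\<^esub> = \<zero>\<^bsub>Q\<^esub>" "add V = add Q"
    "c \<odot>\<^bsub>V\<^esub> v = ?cls (scalar c) \<odot>\<^bsub>Q\<^esub> v" "act V x v = ?cls (gen x) \<odot>\<^bsub>Q\<^esub> v" for c x v
    by (simp_all add: V_def lie_module_of_def Q_def)
  have W_sub: "W \<subseteq> carrier Q" "\<zero>\<^bsub>Q\<^esub> \<in> W" "\<And>v w. v \<in> W \<Longrightarrow> w \<in> W \<Longrightarrow> v \<oplus>\<^bsub>Q\<^esub> w \<in> W"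
    and W_scalar: "\<And>c w. w \<in> W \<Longrightarrow> ?cls (scalar c) \<odot>\<^bsub>Q\<^esub> w \<in> W"
    and W_gen: "\<And>x w. w \<in> W \<Longrightarrow> ?cls (gen x) \<odot>\<^bsub>Q\<^esub> w \<in> W"
  proof -
    interpret W: submodule W "ring_of_type_algebra :: complex ring" V
      using W(1) by (simp add: lie_submodule_def)
    show "W \<subseteq> carrier Q" "\<zero>\<^bsub>Q\<^esub> \<in> W" "\<And>v w. v \<in> W \<Longrightarrow> w \<in> W \<Longrightarrow> v \<oplus>\<^bsub>Q\<^esub> w \<in> W"
      using W.subset W.one_closed W.m_closed by (simp_all add: V)
    show "\<And>c w. w \<in> W \<Longrightarrow> ?cls (scalar c) \<odot>\<^bsub>Q\<^esub> w \<in> W"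
      using W.smult_closed by (simp add: V ring_of_type_algebra_def)
    show "\<And>x w. w \<in> W \<Longrightarrow> ?cls (gen x) \<odot>\<^bsub>Q\<^esub> w \<in> W"
      using W(1) by (simp add: lie_submodule_def V)
  qed
  \<comment> \<open>A Lie submodule is stable under scalars and single letters. Induction over words
    gives stability under the whole enveloping algebra, so the preimage of \<open>W\<close> under
    \<open>ev'\<close> is a left ideal.\<close>
  have W_smult: "?cls q \<odot>\<^bsub>Q\<^esub> w \<in> W" if w: "w \<in> W" for q w
    using subset_UNIV
  proof (induction q rule: poly_mapping_single_induct)
    case zero
    then show ?case using W_scalar[OF w, of 0] by simp
  next
    case (single v c)
    have "?cls (Poly_Mapping.single (FWord xs) c) \<odot>\<^bsub>Q\<^esub> w \<in> W" for xs
    proof (induction xs)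
      case Nil
      then show ?case using W_scalar[OF w, of c] by (simp add: scalar_def zero_fword_def)
    next
      case (Cons x xs)
      have "Poly_Mapping.single (FWord (x # xs)) c = gen x * Poly_Mapping.single (FWord xs) c"
        by (simp add: gen_def mult_single plus_fword_def)
      then show ?case using W_gen[OF Cons] w W_sub(1) cls_closed
        by (auto simp: cls_mult Q.smult_assoc)
    qed
    then show ?case by (cases v) simp
  next
    case (add p q)
    then show ?case using w W_sub cls_closed by (auto simp: cls_add Q.smult_l_distr)
  qed
  obtain w where "w \<in> W" "w \<noteq> \<zero>\<^bsub>Q\<^esub>" using W(2) W_sub(2) unfolding V by blast
  moreover obtain p where "w = ev' p" using ev_surj W_sub(1) calculation by blast
  \<comment> \<open>The filtration argument is run on the preimage of \<open>W\<close>; lying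
    outside the kernel means having a nonzero image.\<close>
  ultimately have "\<exists>p\<in>{p. ev' p \<in> W}. p \<notin> {p. ev' p = \<zero>\<^bsub>Q\<^esub>} \<and>
      (\<forall>x\<in>n. (gen x - scalar (\<phi> x)) * p \<in> {p. ev' p = \<zero>\<^bsub>Q\<^esub>})"
    unfolding n_def by (intro L.whittaker_exists[of p]) (auto simp: ev_mult W_smult)
  then obtain p where p: "ev' p \<in> W" "ev' p \<noteq> \<zero>\<^bsub>Q\<^esub>"
    "\<And>x. x \<in> n \<Longrightarrow> ev' (gen x * p - scalar (\<phi> x) * p) = \<zero>\<^bsub>Q\<^esub>"
    by (auto simp: left_diff_distrib)
  then have "whittaker_vector n \<phi> V (ev' p)"
    by (simp add: whittaker_vector_def V ev_closed ev_diff ev_mult)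
  with p show ?thesis by (auto simp: V)
qed

end
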